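(* There exist an integer $\ell\ge 3$, an integer $k\ge 1$ and a local USP $U\subseteq\{1,2,3\}^k$ such that the triples $A_u,B_u,C_u$ ($u\in U$) of subsets of the abelian group $\mathrm{Cyc}_\ell^k$, defined by $$A_u=\prod_{i=1}^k A(u_i),\qquad B_u=\prod_{i=1}^k B(u_i),\qquad C_u=\prod_{i=1}^k C(u_i),$$ satisfy the simultaneous triple product property, and such that every real number $\tau$ with $$\sum_{u\in U}\big(|A_u||B_u||C_u|\big)^{\tau/3}\le |\mathrm{Cyc}_\ell^k|=\ell^k$$ satisfies $\tau<2.41$. Consequently the exponent $\omega$ of matrix multiplication over $\mathbb{C}$ satisfies $\omega<2.41$.
   Context: The exponent of matrix multiplication $\omega$ (over $\mathbb{C}$) is the smallest real number such that, for each $\varepsilon>0$, $n\times n$ matrix multiplication over $\mathbb{C}$ can be performed in $O(n^{\omega+\varepsilon})$ arithmetic operations. $\mathrm{Cyc}_\ell$ is the cyclic group of order $\ell$, written additively, and $[k]=\{1,\dots,k\}$. With $\widehat H=\mathrm{Cyc}_\ell\setminus\{0,1\}$, the maps $A,B,C$ from $\{1,2,3\}$ to subsets of $\mathrm{Cyc}_\ell$ are: $A(1)=\{0\}$, $B(1)=-\widehat H$, $C(1)=\{0\}$; $A(2)=\{1\}$, $B(2)=\{0\}$, $C(2)=\widehat H$; $A(3)=\widehat H$, $B(3)=\{0\}$, $C(3)=\{0\}$. A local USP of width $k$ is a subset $U\subseteq\{1,2,3\}^k$ such that for each ordered triple $(u,v,w)\in U^3$ with $u,v,w$ not all equal there exists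 $i\in[k]$ such that $(u_i,v_i,w_i)\in\{(1,2,1),(1,2,2),(1,1,3),(1,3,3),(2,2,3),(3,2,3),(1,2,3)\}$. Triple product property: for a subset $S$ of a group, $Q(S)=\{s_1s_2^{-1}:s_1,s_2\in S\}$; $S_1,S_2,S_3$ satisfy the triple product property if $q_i\in Q(S_i)$ and $q_1q_2q_3=1$ imply $q_1=q_2=q_3=1$. A family of triples $A_i,B_i,C_i$ of subsets of an abelian group satisfies the simultaneous triple product property if each triple $A_i,B_i,C_i$ satisfies the triple product property, and for all indices $i,j,k$ and all $a_i\in A_i$, $a_j'\in A_j$, $b_j\in B_j$, $b_k'\in B_k$, $c_k\in C_k$, $c_i'\in C_i$, the equation $a_i-a_j'+b_j-b_k'+c_k-c_i'=0$ implies $i=j=k$. *)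

theory Defs
  imports
    Complex_Main
    "HOL-Library.Landau_Symbols"
    "HOL-Library.FuncSet"
    "HOL-Algebra.Elementary_Groups"
    "HOL-Algebra.Product_Groups"
    "Jordan_Normal_Form.Matrix"
begin

section \<open>The exponent of matrix multiplication\<close>

text \<open>
  Algorithms are straight-line programs over the complex numbers, one for each size. Every
  instruction performs one arithmetic operation; its operands are constants, entries of the two
  input matrices, or results of earlier instructions, and reading them is free of charge.
\<close>

datatype operand =
    Const complex
  | LeftEntry nat nat
  | RightEntry nat nat
  | Result nat

datatype arith_op = Add | Sub | Mul | Div

type_synonym instruction = "arith_op \<times> operand \<times> operand"

fun operand_value :: "complex mat \<Rightarrow> complex mat \<Rightarrow> complex list \<Rightarrow> operand \<Rightarrow> complex option" where
  "operand_value X Y rs (Const z) = Some z"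
| "operand_value X Y rs (LeftEntry i j) =
     (if i < dim_row X \<and> j < dim_col X then Some (X $$ (i, j)) else None)"
| "operand_value X Y rs (RightEntry i j) =
     (if i < dim_row Y \<and> j < dim_col Y then Some (Y $$ (i, j)) else None)"
| "operand_value X Y rs (Result t) = (if t < length rs then Some (rs ! t) else None)"

text \<open>Division by zero is undefined here, in contrast to the total division of the type.\<close>

fun apply_op :: "arith_op \<Rightarrow> complex \<Rightarrow> complex \<Rightarrow> complex option" where
  "apply_op Add x y = Some (x + y)"
| "apply_op Sub x y = Some (x - y)"
| "apply_op Mul x y = Some (x * y)"
| "apply_op Div x y = (if y = 0 then None else Some (x / y))"

text \<open>The list \<open>rs\<close> holds the results computed so far, in order of computation.\<close>

fun run :: "complex mat \<Rightarrow> complex mat \<Rightarrow> instruction list \<Rightarrow> complex list \<Rightarrow> complex list option" where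
  "run X Y [] rs = Some rs"
| "run X Y ((f, a, b) # p) rs =
     Option.bind (operand_value X Y rs a) (\<lambda>x.
     Option.bind (operand_value X Y rs b) (\<lambda>y.
     Option.bind (apply_op f x y) (\<lambda>z.
     run X Y p (rs @ [z]))))"

text \<open>
  The program \<open>p\<close> multiplies \<open>n \<times> n\<close> matrices if, for all inputs, it runs without undefined
  operations and the entry \<open>(i, j)\<close> of the product is then the value of some operand \<open>out i j\<close>
  that does not depend on the input.
\<close>

definition multiplies_matrices :: "nat \<Rightarrow> instruction list \<Rightarrow> bool" where
  "multiplies_matrices n p \<longleftrightarrow>
     (\<exists>out :: nat \<Rightarrow> nat \<Rightarrow> operand.
        \<forall>X \<in> carrier_mat n n. \<forall>Y \<in> carrier_mat n n.
          \<exists>rs. run X Y p [] = Some rs \<and>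
               (\<forall>i<n. \<forall>j<n. operand_value X Y rs (out i j) = Some ((X * Y) $$ (i, j))))"

definition matmul_in_time :: "(nat \<Rightarrow> real) \<Rightarrow> bool" where
  "matmul_in_time g \<longleftrightarrow>
     (\<exists>P :: nat \<Rightarrow> instruction list.
        (\<forall>n. multiplies_matrices n (P n)) \<and> (\<lambda>n. real (length (P n))) \<in> O(g))"

definition matmul_exponent :: real where
  "matmul_exponent = (LEAST w. \<forall>\<epsilon>>0. matmul_in_time (\<lambda>n. real n powr (w + \<epsilon>)))"


section \<open>Triple product properties\<close>

definition quotient_set :: "('a, 'b) monoid_scheme \<Rightarrow> 'a set \<Rightarrow> 'a set" where
  "quotient_set G S = {s \<otimes>\<^bsub>G\<^esub> inv\<^bsub>G\<^esub> t | s t. s \<in> S \<and> t \<in> S}"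

definition triple_product_property ::
    "('a, 'b) monoid_scheme \<Rightarrow> 'a set \<Rightarrow> 'a set \<Rightarrow> 'a set \<Rightarrow> bool" where
  "triple_product_property G S1 S2 S3 \<longleftrightarrow>
     S1 \<subseteq> carrier G \<and> S2 \<subseteq> carrier G \<and> S3 \<subseteq> carrier G \<and>
     (\<forall>q1 \<in> quotient_set G S1. \<forall>q2 \<in> quotient_set G S2. \<forall>q3 \<in> quotient_set G S3.
        q1 \<otimes>\<^bsub>G\<^esub> q2 \<otimes>\<^bsub>G\<^esub> q3 = \<one>\<^bsub>G\<^esub> \<longrightarrow> q1 = \<one>\<^bsub>G\<^esub> \<and> q2 = \<one>\<^bsub>G\<^esub> \<and> q3 = \<one>\<^bsub>G\<^esub>)"

text \<open>Used for abelian groups, here in multiplicative notation.\<close>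

definition simultaneous_triple_product_property ::
    "('a, 'b) monoid_scheme \<Rightarrow> 'i set \<Rightarrow> ('i \<Rightarrow> 'a set) \<Rightarrow> ('i \<Rightarrow> 'a set) \<Rightarrow> ('i \<Rightarrow> 'a set) \<Rightarrow> bool"
  where
  "simultaneous_triple_product_property G I A B C \<longleftrightarrow>
     (\<forall>i\<in>I. triple_product_property G (A i) (B i) (C i)) \<and>
     (\<forall>i\<in>I. \<forall>j\<in>I. \<forall>k\<in>I.
        \<forall>a \<in> A i. \<forall>a' \<in> A j. \<forall>b \<in> B j. \<forall>b' \<in> B k. \<forall>c \<in> C k. \<forall>c' \<in> C i.
          a \<otimes>\<^bsub>G\<^esub> inv\<^bsub>G\<^esub> a' \<otimes>\<^bsub>G\<^esub> b \<otimes>\<^bsub>G\<^esub> inv\<^bsub>G\<^esub> b' \<otimes>\<^bsub>G\<^esub> c \<otimes>\<^bsub>G\<^esub> inv\<^bsub>G\<^esub> c' = \<one>\<^bsub>G\<^esub>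
          \<longrightarrow> i = j \<and> j = k)"


section \<open>Local USPs and the associated triples\<close>

definition local_USP :: "nat \<Rightarrow> (nat \<Rightarrow> nat) set \<Rightarrow> bool" where
  "local_USP k U \<longleftrightarrow>
     U \<subseteq> {1..k} \<rightarrow>\<^sub>E {1, 2, 3} \<and>
     (\<forall>u\<in>U. \<forall>v\<in>U. \<forall>w\<in>U. \<not> (u = v \<and> v = w) \<longrightarrow>
        (\<exists>i\<in>{1..k}. (u i, v i, w i) \<in>
           {(1,2,1), (1,2,2), (1,1,3), (1,3,3), (2,2,3), (3,2,3), (1,2,3)}))"

abbreviation Cyc :: "nat \<Rightarrow> int monoid" where
  "Cyc l \<equiv> integer_mod_group l"

abbreviation Cyc_power :: "nat \<Rightarrow> nat \<Rightarrow> (nat \<Rightarrow> int) monoid" where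
  "Cyc_power l k \<equiv> product_group {1..k} (\<lambda>_. Cyc l)"

definition H_hat :: "nat \<Rightarrow> int set" where
  "H_hat l = carrier (Cyc l) - {0, 1}"

text \<open>Only the values at the symbols 1, 2, 3 matter.\<close>

definition A_set :: "nat \<Rightarrow> nat \<Rightarrow> int set" where
  "A_set l s = (if s = 1 then {0} else if s = 2 then {1} else H_hat l)"

definition B_set :: "nat \<Rightarrow> nat \<Rightarrow> int set" where
  "B_set l s = (if s = 1 then (\<lambda>h. inv\<^bsub>Cyc l\<^esub> h) ` H_hat l else if s = 2 then {0} else {0})"

definition C_set :: "nat \<Rightarrow> nat \<Rightarrow> int set" where
  "C_set l s = (if s = 1 then {0} else if s = 2 then H_hat l else {0})"

definition A_prod :: "nat \<Rightarrow> nat \<Rightarrow> (nat \<Rightarrow> nat) \<Rightarrow> (nat \<Rightarrow> int) set" where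
  "A_prod l k u = (\<Pi>\<^sub>E i\<in>{1..k}. A_set l (u i))"

definition B_prod :: "nat \<Rightarrow> nat \<Rightarrow> (nat \<Rightarrow> nat) \<Rightarrow> (nat \<Rightarrow> int) set" where
  "B_prod l k u = (\<Pi>\<^sub>E i\<in>{1..k}. B_set l (u i))"

definition C_prod :: "nat \<Rightarrow> nat \<Rightarrow> (nat \<Rightarrow> nat) \<Rightarrow> (nat \<Rightarrow> int) set" where
  "C_prod l k u = (\<Pi>\<^sub>E i\<in>{1..k}. C_set l (u i))"

end

theory Submission
  imports
    Defs
    "HOL-Library.Real_Mod"
    "HOL-Real_Asymp.Real_Asymp"
begin

text \<open>
  A local USP with \<open>s\<close> words of width \<open>3n\<close>, each using every symbol \<open>n\<close> times, gives \<open>s\<close> independent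
  products of \<open>8\<^sup>n \<times> 8\<^sup>n\<close> matrices inside the group algebra of \<open>(\<int>/10)\<^bsup>3n\<^esup>\<close>, which the discrete Fourier
  transform turns into \<open>1000\<^sup>n\<close> scalar multiplications. Grouping these multiplications into \<open>q\<close> groups
  of \<open>s\<close> and recursing on each group computes \<open>s\<close> products of size \<open>8\<^bsup>nh\<^esup>\<close> with \<open>O(q\<^sup>h)\<close> operations,
  so the exponent is at most \<open>log 8\<^sup>n q\<close>; this avoids tensor powers and border rank.

  Large local USPs come from the hashing argument of Coppersmith and Winograd. A balanced word is a
  partition of the coordinates into three blocks of equal size. Random linear hash functions of the
  blocks, required to take a common value in a set without three-term arithmetic progressions, leave
  few blocks that are shared by two surviving words, and the words sharing no block form a local USP.
  Their number grows like \<open>(27/4)\<^sup>n\<close>, while \<open>1000\<^sup>n / 8\<^bsup>2.41n\<^esup> < (1000/150)\<^sup>n\<close>.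
\<close>

section \<open>Straight-line programs\<close>

text \<open>The bound leaves little slack. The words constructed here have pairwise different
  blocks, so there are at most (3n choose n) of them, about (27/4)^n. With that many words the
  exponent is log(4 * l^3 / 27) / log(l - 2); the choice l = 10 minimises this and gives about
  2.404. Since 8^2.41 is only slightly above 150 and 150 * 27/4 = 1012.5, the hashing may lose no
  more than a factor of 1.0125^n. The modulus is about 4^n, so a progression-free set of size M^c
  with a fixed c noticeably below 1 would be too small. This is why Behrend's dense sets are used.

  Using every symbol equally often makes all sets A_u, B_u, C_u equally large. The independent
  products are then square and of one size, as the recursion requires.

  The single estimate 2 * 1000^n \<le> |U| * 150^n yields both conclusions. The bound on the
  exponent is drawn from it directly, not through the inequality for \<tau>.\<close>

type_synonym entry_fun = "complex mat \<Rightarrow> complex mat \<Rightarrow> complex"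

text \<open>The operand is fixed before the inputs, as the outputs are in
  \<open>multiplies_matrices\<close>. Intermediate values are thus functions of the two input
  matrices.\<close>

definition computes :: "nat \<Rightarrow> instruction list \<Rightarrow> entry_fun \<Rightarrow> bool" where
  "computes N p f \<longleftrightarrow> (\<exists>a. \<forall>X\<in>carrier_mat N N. \<forall>Y\<in>carrier_mat N N.
     \<exists>rs. run X Y p [] = Some rs \<and> operand_value X Y rs a = Some (f X Y))"

definition const_funs :: "entry_fun set" where
  "const_funs = {\<lambda>X Y. z | z. True}"

text \<open>Quantifying over every program that already computes \<open>S\<close> lets estimates be
  chained and results be shared without tracking addresses. The clause on constants expresses that
  the program runs without undefined operations, also when \<open>S\<close> is empty.\<close>

definition cost_le :: "nat \<Rightarrow> entry_fun set \<Rightarrow> nat \<Rightarrow> entry_fun set \<Rightarrow> bool" where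
  "cost_le N S L T \<longleftrightarrow>
     (\<forall>p. (\<forall>z. computes N p (\<lambda>X Y. z)) \<and> (\<forall>f\<in>S. computes N p f) \<longrightarrow>
        (\<exists>p'. length p' \<le> L \<and> (\<forall>z. computes N (p @ p') (\<lambda>X Y. z)) \<and>
           (\<forall>f\<in>S \<union> T. computes N (p @ p') f)))"

lemma run_append: "run X Y (p @ q) rs = Option.bind (run X Y p rs) (run X Y q)"
proof (induction p arbitrary: rs)
  case (Cons ins p)
  obtain f a b where ins: "ins = (f, a, b)" by (cases ins)
  show ?case
    by (simp add: ins Cons.IH split: Option.bind_split)
qed simp

lemma operand_value_append:
  "operand_value X Y rs a = Some x \<Longrightarrow> operand_value X Y (rs @ rs') a = Some x"
  by (cases a) (auto simp: nth_append split: if_splits)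

lemma run_extends: "run X Y q rs = Some rs' \<Longrightarrow> \<exists>zs. rs' = rs @ zs \<and> length zs = length q"
proof (induction q arbitrary: rs)
  case (Cons ins q)
  obtain f a b where ins: "ins = (f, a, b)" by (cases ins)
  from Cons.prems obtain z where "run X Y q (rs @ [z]) = Some rs'"
    by (auto simp: ins bind_eq_Some_conv)
  from Cons.IH[OF this] show ?case by auto
qed simp

text \<open>Operands address results by absolute position and new results are appended at the end,
  so old operands keep their values.\<close>

lemma computes_append:
  assumes "computes N p f"
    and "\<And>X Y. X \<in> carrier_mat N N \<Longrightarrow> Y \<in> carrier_mat N N \<Longrightarrow> run X Y (p @ q) [] \<noteq> None"
  shows "computes N (p @ q) f"
proof -
  obtain a where a: "\<And>X Y. X \<in> carrier_mat N N \<Longrightarrow> Y \<in> carrier_mat N N \<Longrightarrow>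
     \<exists>rs. run X Y p [] = Some rs \<and> operand_value X Y rs a = Some (f X Y)"
    using assms(1) unfolding computes_def by blast
  have "\<exists>rs. run X Y (p @ q) [] = Some rs \<and> operand_value X Y rs a = Some (f X Y)"
    if XY: "X \<in> carrier_mat N N" "Y \<in> carrier_mat N N" for X Y
  proof -
    obtain rs where rs: "run X Y p [] = Some rs" "operand_value X Y rs a = Some (f X Y)"
      using a[OF XY] by blast
    obtain rs' where rs': "run X Y (p @ q) [] = Some rs'"
      using assms(2)[OF XY] by blast
    then have "run X Y q rs = Some rs'"
      using rs(1) by (simp add: run_append)
    then obtain zs where "rs' = rs @ zs"
      using run_extends by blast
    then show ?thesis
      using rs(2) rs' operand_value_append by simp
  qed
  then show ?thesis unfolding computes_def by blast
qed

lemma cost_le_op: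
  assumes "op \<noteq> Div" and "\<And>X Y. apply_op op (f X Y) (g X Y) = Some (h X Y)"
  shows "cost_le N {f, g} 1 {h}"
  unfolding cost_le_def
proof (intro allI impI)
  fix p assume "(\<forall>z. computes N p (\<lambda>X Y. z)) \<and> (\<forall>e\<in>{f, g}. computes N p e)"
  then have cz: "\<And>z. computes N p (\<lambda>X Y. z)" and "computes N p f" "computes N p g"
    by auto
  then obtain a b where
    a: "\<And>X Y. X \<in> carrier_mat N N \<Longrightarrow> Y \<in> carrier_mat N N \<Longrightarrow>
      \<exists>rs. run X Y p [] = Some rs \<and> operand_value X Y rs a = Some (f X Y)" and
    b: "\<And>X Y. X \<in> carrier_mat N N \<Longrightarrow> Y \<in> carrier_mat N N \<Longrightarrow>
      \<exists>rs. run X Y p [] = Some rs \<and> operand_value X Y rs b = Some (g X Y)"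
    unfolding computes_def by blast
  have runs: "\<exists>rs. run X Y p [] = Some rs \<and> run X Y (p @ [(op, a, b)]) [] = Some (rs @ [h X Y])"
    if "X \<in> carrier_mat N N" "Y \<in> carrier_mat N N" for X Y
    using a[OF that] b[OF that] assms(2)[of X Y] by (auto simp: run_append)
  have keep: "computes N (p @ [(op, a, b)]) e" if "computes N p e" for e
    by (rule computes_append[OF that]) (use runs in force)
  have "\<exists>rs. run X Y (p @ [(op, a, b)]) [] = Some rs \<and>
      operand_value X Y rs (Result (length p)) = Some (h X Y)"
    if XY: "X \<in> carrier_mat N N" "Y \<in> carrier_mat N N" for X Y
  proof -
    obtain rs where rs: "run X Y p [] = Some rs"
      "run X Y (p @ [(op, a, b)]) [] = Some (rs @ [h X Y])"
      using runs[OF XY] by blast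
    then have "length rs = length p"
      using run_extends by fastforce
    then show ?thesis using rs(2) by (simp add: nth_append)
  qed
  then have new: "computes N (p @ [(op, a, b)]) h" unfolding computes_def by blast
  have "\<forall>z. computes N (p @ [(op, a, b)]) (\<lambda>X Y. z)"
    "\<forall>e\<in>{f, g} \<union> {h}. computes N (p @ [(op, a, b)]) e"
    using cz keep new \<open>computes N p f\<close> \<open>computes N p g\<close> by blast+
  moreover have "length [(op, a, b)] \<le> 1" by simp
  ultimately show "\<exists>p'. length p' \<le> 1 \<and> (\<forall>z. computes N (p @ p') (\<lambda>X Y. z)) \<and>
           (\<forall>e\<in>{f, g} \<union> {h}. computes N (p @ p') e)"
    by blast
qed

lemma cost_le_add: "cost_le N {f, g} 1 {\<lambda>X Y. f X Y + g X Y}"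
  by (rule cost_le_op[of Add]) auto

lemma cost_le_mult: "cost_le N {f, g} 1 {\<lambda>X Y. f X Y * g X Y}"
  by (rule cost_le_op[of Mul]) auto

lemma cost_le_refl:
  assumes "T \<subseteq> S \<union> const_funs"
  shows "cost_le N S 0 T"
proof -
  have "\<forall>f\<in>S \<union> T. computes N (p @ []) f"
    if "\<forall>z. computes N p (\<lambda>X Y. z)" "\<forall>f\<in>S. computes N p f" for p
    using that assms unfolding const_funs_def by fastforce
  then show ?thesis
    unfolding cost_le_def by (metis append_Nil2 le_refl list.size(3))
qed

lemma cost_le_trans:
  assumes "cost_le N S L T" "cost_le N S' L' T'" "S' \<subseteq> S \<union> T \<union> const_funs"
  shows "cost_le N S (L + L') (T \<union> T')"
  unfolding cost_le_def
proof (intro allI impI)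
  fix p assume *: "(\<forall>z. computes N p (\<lambda>X Y. z)) \<and> (\<forall>f\<in>S. computes N p f)"
  from assms(1)[unfolded cost_le_def, THEN spec, THEN mp, OF *]
  obtain p' where p': "length p' \<le> L" "\<forall>z. computes N (p @ p') (\<lambda>X Y. z)"
    "\<forall>f\<in>S \<union> T. computes N (p @ p') f"
    by (elim exE conjE)
  have "computes N (p @ p') f" if "f \<in> S'" for f
    using that assms(3) p'(2,3) by (auto simp: const_funs_def)
  with p'(2) have "(\<forall>z. computes N (p @ p') (\<lambda>X Y. z)) \<and> (\<forall>f\<in>S'. computes N (p @ p') f)"
    by (intro conjI ballI)
  from assms(2)[unfolded cost_le_def, THEN spec, THEN mp, OF this]
  obtain p'' where p'': "length p'' \<le> L'" "\<forall>z. computes N ((p @ p') @ p'') (\<lambda>X Y. z)"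
    "\<forall>f\<in>S' \<union> T'. computes N ((p @ p') @ p'') f"
    by (elim exE conjE)
  have runs: "run X Y ((p @ p') @ p'') [] \<noteq> None"
    if "X \<in> carrier_mat N N" "Y \<in> carrier_mat N N" for X Y
    using p''(2)[THEN spec, of 0] that unfolding computes_def by fastforce
  have keep: "computes N ((p @ p') @ p'') f" if "computes N (p @ p') f" for f
    by (rule computes_append[OF that runs])
  have "length (p' @ p'') \<le> L + L'"
    using p'(1) p''(1) by simp
  moreover have "\<forall>z. computes N (p @ (p' @ p'')) (\<lambda>X Y. z)"
    using p''(2) by simp
  moreover have "\<forall>f\<in>S \<union> (T \<union> T'). computes N (p @ (p' @ p'')) f"
  proof
    fix f assume "f \<in> S \<union> (T \<union> T')"
    then consider "f \<in> S \<union> T" | "f \<in> S' \<union> T'" by blast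
    then have "computes N ((p @ p') @ p'') f"
      by cases (use keep p'(3) p''(3) in auto)
    then show "computes N (p @ (p' @ p'')) f" by simp
  qed
  ultimately show "\<exists>q. length q \<le> L + L' \<and> (\<forall>z. computes N (p @ q) (\<lambda>X Y. z)) \<and>
           (\<forall>f\<in>S \<union> (T \<union> T'). computes N (p @ q) f)"
    by (intro exI[of _ "p' @ p''"] conjI)
qed

lemma cost_le_mono:
  assumes "cost_le N S L T" "S \<subseteq> S' \<union> const_funs" "L \<le> L'"
    "T' \<subseteq> S' \<union> T \<union> const_funs"
  shows "cost_le N S' L' T'"
proof -
  have "cost_le N S' 0 {}" by (rule cost_le_refl) simp
  then have "cost_le N S' (0 + L) ({} \<union> T)"
    by (rule cost_le_trans[OF _ assms(1)]) (use assms(2) in simp)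
  then have L: "cost_le N S' L T" by simp
  have "cost_le N (S' \<union> T) 0 T'"
    by (rule cost_le_refl) (use assms(4) in simp)
  then have "cost_le N S' (L + 0) (T \<union> T')"
    by (rule cost_le_trans[OF L]) simp
  then show ?thesis
    using assms(3) unfolding cost_le_def Ball_def Un_iff add_0_right by (meson order_trans)
qed

lemma cost_le_weaken:
  assumes "cost_le N S L T" "S \<subseteq> S'" "L \<le> L'" "T' \<subseteq> T"
  shows "cost_le N S' L' T'"
  by (rule cost_le_mono[OF assms(1) _ assms(3)]) (use assms in auto)

lemma cost_le_UN:
  assumes "finite I" "\<And>i. i \<in> I \<Longrightarrow> cost_le N S (L i) (T i)"
  shows "cost_le N S (\<Sum>i\<in>I. L i) (\<Union>i\<in>I. T i)"
  using assms
proof (induction I)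
  case empty
  then show ?case by (simp add: cost_le_refl)
next
  case (insert i I)
  have "cost_le N S (L i + (\<Sum>i\<in>I. L i)) (T i \<union> (\<Union>i\<in>I. T i))"
    by (rule cost_le_trans) (use insert in auto)
  then show ?case using insert by simp
qed

text \<open>Each term costs a multiplication by its coefficient and an addition; the sum starts from
  the constant 0, which is free.\<close>

lemma cost_le_lincomb:
  assumes "finite J"
  shows "cost_le N (f ` J) (2 * card J) {\<lambda>X Y. \<Sum>j\<in>J. c j * f j X Y}"
  using assms
proof (induction J)
  case empty
  have "(\<lambda>X Y. 0) \<in> const_funs" unfolding const_funs_def by blast
  then show ?case using cost_le_refl[of "{\<lambda>X Y. 0}" "{}" N] by simp
next
  case (insert j J)
  let ?s = "\<lambda>X Y. \<Sum>j\<in>J. c j * f j X Y" and ?m = "\<lambda>X Y. c j * f j X Y"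
  have 1: "cost_le N (f ` insert j J) (2 * card J) {?s}"
    by (rule cost_le_mono[OF insert.IH]) auto
  have const: "(\<lambda>X Y. c j) \<in> const_funs"
    unfolding const_funs_def by blast
  have 2: "cost_le N (f ` insert j J) (2 * card J + 1) ({?s} \<union> {?m})"
    using const by (intro cost_le_trans[OF 1 cost_le_mult[of N "\<lambda>X Y. c j" "f j"]]) simp
  have "cost_le N (f ` insert j J) (2 * card J + 1 + 1) ({?s} \<union> {?m} \<union> {\<lambda>X Y. ?m X Y + ?s X Y})"
    by (intro cost_le_trans[OF 2 cost_le_add[of N ?m ?s]]) simp
  moreover have "(\<lambda>X Y. \<Sum>j\<in>insert j J. c j * f j X Y) = (\<lambda>X Y. ?m X Y + ?s X Y)"
    using insert.hyps by simp
  ultimately have "cost_le N (f ` insert j J) (2 * card J + 1 + 1)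
      ({?s} \<union> {?m} \<union> {\<lambda>X Y. \<Sum>j\<in>insert j J. c j * f j X Y})"
    by simp
  then show ?case
    by (rule cost_le_mono) (use insert.hyps in auto)
qed

section \<open>Recursive multiplication of independent matrices\<close>

text \<open>Row and column indices of matrices of size \<open>n ^ h\<close>, written in base
  \<open>n\<close>: the first letter selects a block, the remaining letters a position inside
  it.\<close>

definition index_words :: "nat \<Rightarrow> nat \<Rightarrow> nat list set" where
  "index_words n h = {xs. set xs \<subseteq> {..<n} \<and> length xs = h}"

lemma finite_index_words [simp]: "finite (index_words n h)"
  unfolding index_words_def by (simp add: finite_lists_length_eq)

lemma card_index_words [simp]: "card (index_words n h) = n ^ h"
  unfolding index_words_def by (simp add: card_lists_length_eq)

lemma index_words_0 [simp]: "index_words n 0 = {[]}"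
  by (auto simp: index_words_def)

lemma index_words_Suc:
  "index_words n (Suc h) = (\<lambda>(a, as). a # as) ` ({..<n} \<times> index_words n h)"
  by (auto simp: index_words_def length_Suc_conv image_iff)

lemma sum_index_words_Suc:
  "(\<Sum>w\<in>index_words n (Suc h). g w) = (\<Sum>as\<in>index_words n h. \<Sum>a<n. g (a # as))"
proof -
  have "inj_on (\<lambda>(a, as). a # as) ({..<n} \<times> index_words n h)"
    by (auto simp: inj_on_def)
  then have "(\<Sum>w\<in>index_words n (Suc h). g w) = (\<Sum>(a, as)\<in>{..<n} \<times> index_words n h. g (a # as))"
    unfolding index_words_Suc by (subst sum.reindex) (auto simp: o_def case_prod_unfold)
  also have "\<dots> = (\<Sum>as\<in>index_words n h. \<Sum>a<n. g (a # as))"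
    by (subst sum.swap) (simp flip: sum.cartesian_product)
  finally show ?thesis .
qed

text \<open>
  The coefficient \<open>\<alpha> t j a b\<close> belongs to the entry \<open>(a, b)\<close> of the \<open>j\<close>-th left factor in the
  product number \<open>t\<close>. The products come in \<open>q\<close> groups of \<open>s\<close>, which lets the recursion
  apply the scheme to each group again.
\<close>

definition disjoint_product_scheme :: "nat \<Rightarrow> nat \<Rightarrow> nat \<Rightarrow>
    (nat \<times> nat \<Rightarrow> nat \<Rightarrow> nat \<Rightarrow> nat \<Rightarrow> complex) \<Rightarrow>
    (nat \<times> nat \<Rightarrow> nat \<Rightarrow> nat \<Rightarrow> nat \<Rightarrow> complex) \<Rightarrow>
    (nat \<times> nat \<Rightarrow> nat \<Rightarrow> nat \<Rightarrow> nat \<Rightarrow> complex) \<Rightarrow> bool" where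
  "disjoint_product_scheme s n q \<alpha> \<beta> \<gamma> \<longleftrightarrow>
     (\<forall>i<s. \<forall>j<s. \<forall>k<s. \<forall>a<n. \<forall>a'<n. \<forall>b<n. \<forall>b'<n. \<forall>c<n. \<forall>c'<n.
        (\<Sum>t\<in>{..<q} \<times> {..<s}. \<alpha> t j a' b * \<beta> t k b' c * \<gamma> t i a c') =
        (if i = j \<and> j = k \<and> a = a' \<and> b = b' \<and> c = c' then 1 else 0))"

text \<open>The scheme is applied to matrices of blocks. For fixed outer positions, \<open>w\<close>
  runs over the inner index of a product of two blocks, and bilinearity reduces the claim to the
  scalar identity for each \<open>w\<close>.\<close>

lemma disjoint_product_scheme_eval:
  assumes "disjoint_product_scheme s n q \<alpha> \<beta> \<gamma>" "i < s" "a < n" "c < n" "finite B"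
  shows "(\<Sum>t\<in>{..<q} \<times> {..<s}. \<gamma> t i a c *
      (\<Sum>w\<in>B. (\<Sum>(j, a', b)\<in>{..<s} \<times> {..<n} \<times> {..<n}. \<alpha> t j a' b * x j a' b w) *
              (\<Sum>(k, b', c')\<in>{..<s} \<times> {..<n} \<times> {..<n}. \<beta> t k b' c' * y k b' c' w))) =
    (\<Sum>w\<in>B. \<Sum>b<n. x i a b w * y i b c w)"
proof -
  let ?T = "{..<q} \<times> {..<s}" and ?S = "{..<s} \<times> {..<n} \<times> {..<n}"
  have "(\<Sum>t\<in>?T. \<gamma> t i a c *
      ((\<Sum>(j, a', b)\<in>?S. \<alpha> t j a' b * x j a' b w) * (\<Sum>(k, b', c')\<in>?S. \<beta> t k b' c' * y k b' c' w)))
    = (\<Sum>b<n. x i a b w * y i b c w)" for w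
  proof -
    have "(\<Sum>t\<in>?T. \<gamma> t i a c *
        ((\<Sum>(j, a', b)\<in>?S. \<alpha> t j a' b * x j a' b w) * (\<Sum>(k, b', c')\<in>?S. \<beta> t k b' c' * y k b' c' w)))
      = (\<Sum>t\<in>?T. \<Sum>(j, a', b)\<in>?S. \<Sum>(k, b', c')\<in>?S.
          x j a' b w * y k b' c' w * (\<alpha> t j a' b * \<beta> t k b' c' * \<gamma> t i a c))"
      by (simp add: sum_product sum_distrib_left case_prod_unfold mult_ac)
        (rule sum.cong[OF refl], rule sum.swap)
    also have "\<dots> = (\<Sum>(j, a', b)\<in>?S. \<Sum>(k, b', c')\<in>?S. x j a' b w * y k b' c' w *
        (\<Sum>t\<in>?T. \<alpha> t j a' b * \<beta> t k b' c' * \<gamma> t i a c))"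
      by (subst sum.swap, rule sum.cong[OF refl], clarify, subst sum.swap)
        (simp add: sum_distrib_left case_prod_unfold)
    also have "\<dots> = (\<Sum>(j, a', b)\<in>?S. \<Sum>(k, b', c')\<in>?S. x j a' b w * y k b' c' w *
        (if i = j \<and> j = k \<and> a = a' \<and> b = b' \<and> c' = c then 1 else 0))"
    proof -
      have "(\<Sum>t\<in>?T. \<alpha> t j a' b * \<beta> t k b' c' * \<gamma> t i a c) =
          (if i = j \<and> j = k \<and> a = a' \<and> b = b' \<and> c' = c then 1 else 0)"
        if "j < s" "k < s" "a' < n" "b < n" "b' < n" "c' < n" for j k a' b b' c'
        using assms that unfolding disjoint_product_scheme_def by simp
      then show ?thesis
        by (intro sum.cong refl, clarify) (intro sum.cong refl, clarify, simp)
    qed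
    also have "\<dots> = (\<Sum>(j, a', b)\<in>?S. if j = i \<and> a' = a then x j a' b w * y i b c w else 0)"
    proof (intro sum.cong refl, clarify)
      fix j a' b assume *: "j < s" "a' < n" "b < n"
      have "(\<Sum>(k, b', c')\<in>?S. x j a' b w * y k b' c' w *
          (if i = j \<and> j = k \<and> a = a' \<and> b = b' \<and> c' = c then 1 else 0)) =
        (\<Sum>r\<in>?S. if r = (i, b, c) then (if j = i \<and> a' = a then x j a' b w * y i b c w else 0) else 0)"
      proof (intro sum.cong refl, clarify)
        fix k b' c'
        have eq: "(i = j \<and> j = k \<and> a = a' \<and> b = b' \<and> c' = c) \<longleftrightarrow> (k, b', c') = (i, b, c) \<and> j = i \<and> a' = a"
          by auto
        show "x j a' b w * y k b' c' w * (if i = j \<and> j = k \<and> a = a' \<and> b = b' \<and> c' = c then 1 else 0) =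
          (if (k, b', c') = (i, b, c) then (if j = i \<and> a' = a then x j a' b w * y i b c w else 0) else 0)"
          unfolding eq
          by (cases "(k, b', c') = (i, b, c)") (simp, simp only: if_False simp_thms mult_zero_right)
      qed
      also have "\<dots> = (if j = i \<and> a' = a then x j a' b w * y i b c w else 0)"
        using * assms(2,4) by (subst sum.delta) auto
      finally show "(\<Sum>(k, b', c')\<in>?S. x j a' b w * y k b' c' w *
          (if i = j \<and> j = k \<and> a = a' \<and> b = b' \<and> c' = c then 1 else 0)) =
        (if j = i \<and> a' = a then x j a' b w * y i b c w else 0)" .
    qed
    also have "\<dots> = (\<Sum>(j, a', b)\<in>{i} \<times> {a} \<times> {..<n}. x j a' b w * y i b c w)"
    proof (rule trans)
      show "(\<Sum>(j, a', b)\<in>?S. if j = i \<and> a' = a then x j a' b w * y i b c w else 0) =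
          (\<Sum>(j, a', b)\<in>{i} \<times> {a} \<times> {..<n}. if j = i \<and> a' = a then x j a' b w * y i b c w else 0)"
      proof (rule sum.mono_neutral_right)
        show "{i} \<times> {a} \<times> {..<n} \<subseteq> ?S" using assms(2,3) by auto
        show "\<forall>r\<in>?S - {i} \<times> {a} \<times> {..<n}.
            (case r of (j, a', b) \<Rightarrow> if j = i \<and> a' = a then x j a' b w * y i b c w else 0) = 0"
          by (auto split: if_split_asm)
      qed simp
    qed (auto intro: sum.cong)
    also have "\<dots> = (\<Sum>b<n. x i a b w * y i b c w)"
      by (simp flip: sum.cartesian_product)
    finally show ?thesis .
  qed
  then have "(\<Sum>w\<in>B. \<Sum>t\<in>?T. \<gamma> t i a c *
      ((\<Sum>(j, a', b)\<in>?S. \<alpha> t j a' b * x j a' b w) * (\<Sum>(k, b', c')\<in>?S. \<beta> t k b' c' * y k b' c' w)))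
    = (\<Sum>w\<in>B. \<Sum>b<n. x i a b w * y i b c w)"
    by simp
  then show ?thesis
    by (subst (asm) sum.swap) (simp add: sum_distrib_left)
qed

text \<open>One level makes \<open>q\<close> recursive calls. Forming the \<open>q * s\<close> left
  and right factors, of \<open>n ^ (2 * h)\<close> entries each, takes
  \<open>2 * s * n\<^sup>2\<close> operations per entry. Recombination takes
  \<open>2 * q * s\<close> operations for each of the \<open>s * n ^ (2 * h + 2)\<close> output
  entries. Together this gives the constant 4 + 2 = 6.\<close>

fun scheme_cost :: "nat \<Rightarrow> nat \<Rightarrow> nat \<Rightarrow> nat \<Rightarrow> nat" where
  "scheme_cost s n q 0 = s"
| "scheme_cost s n q (Suc h) = q * scheme_cost s n q h + 6 * q * s\<^sup>2 * n\<^sup>2 * (n\<^sup>2) ^ h"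

definition entry_set :: "nat \<Rightarrow> 'b set \<Rightarrow> (nat \<Rightarrow> 'b \<Rightarrow> 'b \<Rightarrow> entry_fun) \<Rightarrow> entry_fun set" where
  "entry_set s I x = (\<lambda>(j, a, b). x j a b) ` ({..<s} \<times> I \<times> I)"

lemma entry_setI: "j < s \<Longrightarrow> a \<in> I \<Longrightarrow> b \<in> I \<Longrightarrow> x j a b \<in> entry_set s I x"
  unfolding entry_set_def by (rule image_eqI[of _ _ "(j, a, b)"]) simp_all

lemma entry_set_singleton: "entry_set s {e} x = (\<lambda>j. x j e e) ` {..<s}"
proof -
  have "{..<s} \<times> {e} \<times> {e} = (\<lambda>j. (j, e, e)) ` {..<s}" by auto
  then show ?thesis by (simp add: entry_set_def image_image)
qed

lemma entry_set_subsetI: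
  "(\<And>j a b. j < s \<Longrightarrow> a \<in> I \<Longrightarrow> b \<in> I \<Longrightarrow> x j a b \<in> T) \<Longrightarrow> entry_set s I x \<subseteq> T"
  unfolding entry_set_def by auto

text \<open>The scheme turns \<open>s\<close> products of size \<open>n ^ Suc h\<close> into
  \<open>q * s\<close> products \<open>P t * Q t\<close> of linear combinations of blocks, of size
  \<open>n ^ h\<close>. The inputs are generalised in the induction because these combinations
  replace them.\<close>

lemma cost_le_disjoint_products:
  assumes scheme: "disjoint_product_scheme s n q \<alpha> \<beta> \<gamma>"
  shows "cost_le N (entry_set s (index_words n h) x \<union> entry_set s (index_words n h) y)
    (scheme_cost s n q h)
    (entry_set s (index_words n h) (\<lambda>j a c X Y. \<Sum>b\<in>index_words n h. x j a b X Y * y j b c X Y))"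
proof (induction h arbitrary: x y)
  case 0
  have "cost_le N (entry_set s {[]} x \<union> entry_set s {[]} y) (\<Sum>j<s. 1)
      (\<Union>j<s. {\<lambda>X Y. x j [] [] X Y * y j [] [] X Y})"
  proof (rule cost_le_UN)
    fix j assume "j \<in> {..<s}"
    then have "{x j [] [], y j [] []} \<subseteq> entry_set s {[]} x \<union> entry_set s {[]} y"
      by (simp add: entry_setI)
    then show "cost_le N (entry_set s {[]} x \<union> entry_set s {[]} y) 1
        {\<lambda>X Y. x j [] [] X Y * y j [] [] X Y}"
      by (rule cost_le_weaken[OF cost_le_mult]) simp_all
  qed simp
  moreover have "(\<Union>j<s. {\<lambda>X Y. x j [] [] X Y * y j [] [] X Y}) =
      entry_set s {[]} (\<lambda>j a c X Y. \<Sum>b\<in>{[]}. x j a b X Y * y j b c X Y)"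
    by (simp add: entry_set_singleton UNION_singleton_eq_range)
  ultimately show ?case by simp
next
  case (Suc h)
  let ?T = "{..<q} \<times> {..<s}" and ?S = "{..<s} \<times> {..<n} \<times> {..<n}" and ?I = "index_words n h"
  let ?J = "index_words n (Suc h)"
  define P where "P = (\<lambda>t as bs X Y. \<Sum>(j, a, b)\<in>?S. \<alpha> t j a b * x j (a # as) (b # bs) X Y)"
  define Q where "Q = (\<lambda>t as bs X Y. \<Sum>(j, a, b)\<in>?S. \<beta> t j a b * y j (a # as) (b # bs) X Y)"
  define R where "R = (\<lambda>t as cs X Y. \<Sum>bs\<in>?I. P t as bs X Y * Q t bs cs X Y)"
  let ?in = "entry_set s ?J x \<union> entry_set s ?J y"
  let ?PQ = "\<Union>(t, as, bs)\<in>?T \<times> ?I \<times> ?I. {P t as bs} \<union> {Q t as bs}"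
  let ?R = "\<Union>t\<in>{..<q}. entry_set s ?I (\<lambda>j. R (t, j))"
  have lin: "cost_le N (entry_set s ?J z) (2 * (s * n\<^sup>2))
      {\<lambda>X Y. \<Sum>(j, a, b)\<in>?S. \<delta> j a b * z j (a # as) (b # bs) X Y}"
    if "as \<in> ?I" "bs \<in> ?I" for z \<delta> as bs
  proof -
    have "cost_le N ((\<lambda>(j, a, b). z j (a # as) (b # bs)) ` ?S) (2 * card ?S)
        {\<lambda>X Y. \<Sum>r\<in>?S. (case r of (j, a, b) \<Rightarrow> \<delta> j a b) * (case r of (j, a, b) \<Rightarrow> z j (a # as) (b # bs)) X Y}"
      by (rule cost_le_lincomb) simp
    then have "cost_le N ((\<lambda>(j, a, b). z j (a # as) (b # bs)) ` ?S) (2 * (s * n\<^sup>2))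
        {\<lambda>X Y. \<Sum>(j, a, b)\<in>?S. \<delta> j a b * z j (a # as) (b # bs) X Y}"
      by (simp add: case_prod_unfold power2_eq_square)
    moreover have "(\<lambda>(j, a, b). z j (a # as) (b # bs)) ` ?S \<subseteq> entry_set s ?J z"
      using that by (auto simp: index_words_Suc intro!: entry_setI)
    ultimately show ?thesis
      by (rule cost_le_weaken) simp_all
  qed
  have "cost_le N ?in (\<Sum>(t, as, bs)\<in>?T \<times> ?I \<times> ?I. 2 * (s * n\<^sup>2) + 2 * (s * n\<^sup>2)) ?PQ"
  proof (rule cost_le_UN)
    fix r assume "r \<in> ?T \<times> ?I \<times> ?I"
    then obtain t as bs where r: "r = (t, as, bs)" "as \<in> ?I" "bs \<in> ?I" by auto
    have "cost_le N ?in (2 * (s * n\<^sup>2)) {P t as bs}" "cost_le N ?in (2 * (s * n\<^sup>2)) {Q t as bs}"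
      unfolding P_def Q_def by (rule cost_le_weaken[OF lin[OF r(2,3)]]; simp)+
    then have "cost_le N ?in (2 * (s * n\<^sup>2) + 2 * (s * n\<^sup>2)) ({P t as bs} \<union> {Q t as bs})"
      by (rule cost_le_trans) auto
    then show "cost_le N ?in (case r of (t, as, bs) \<Rightarrow> 2 * (s * n\<^sup>2) + 2 * (s * n\<^sup>2))
      (case r of (t, as, bs) \<Rightarrow> {P t as bs} \<union> {Q t as bs})"
      by (simp add: r)
  qed simp
  then have PQ: "cost_le N ?in (q * s * ((n\<^sup>2) ^ h * (4 * (s * n\<^sup>2)))) ?PQ"
    by (rule cost_le_weaken)
      (simp_all add: case_prod_unfold power_mult_distrib power2_eq_square)
  have "cost_le N ?PQ (\<Sum>t<q. scheme_cost s n q h) ?R"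
  proof (rule cost_le_UN)
    \<comment> \<open>For a fixed first index \<open>t\<close>, the \<open>s\<close> products
      numbered \<open>(t, j)\<close> have unrelated factors, so they are again \<open>s\<close>
      independent products and the induction hypothesis treats them together.\<close>
    fix t assume t: "t \<in> {..<q}"
    show "cost_le N ?PQ (scheme_cost s n q h) (entry_set s ?I (\<lambda>j. R (t, j)))"
      unfolding R_def
    proof (rule cost_le_weaken[OF Suc.IH[of "\<lambda>j. P (t, j)" "\<lambda>j. Q (t, j)"]])
      show "entry_set s ?I (\<lambda>j. P (t, j)) \<union> entry_set s ?I (\<lambda>j. Q (t, j)) \<subseteq> ?PQ"
        using t by (intro Un_least entry_set_subsetI) (auto intro!: bexI)
    qed simp_all
  qed simp
  then have R: "cost_le N ?PQ (q * scheme_cost s n q h) ?R"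
    by simp
  let ?Z = "\<lambda>j a c X Y. \<Sum>b\<in>?J. x j a b X Y * y j b c X Y"
  have "cost_le N ?R (\<Sum>(i, a, c)\<in>{..<s} \<times> ?J \<times> ?J. 2 * (q * s))
    (\<Union>(i, a, c)\<in>{..<s} \<times> ?J \<times> ?J. {?Z i a c})"
  proof (rule cost_le_UN)
    fix r assume "r \<in> {..<s} \<times> ?J \<times> ?J"
    then obtain i a as c cs where r: "r = (i, a # as, c # cs)" and
      i: "i < s" "a < n" "as \<in> ?I" "c < n" "cs \<in> ?I"
      unfolding index_words_Suc by auto
    have "cost_le N ((\<lambda>t. R t as cs) ` ?T) (2 * card ?T) {\<lambda>X Y. \<Sum>t\<in>?T. \<gamma> t i a c * R t as cs X Y}"
      by (rule cost_le_lincomb) simp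
    moreover have "(\<lambda>X Y. \<Sum>t\<in>?T. \<gamma> t i a c * R t as cs X Y) = ?Z i (a # as) (c # cs)"
    proof (intro ext)
      fix X Y
      show "(\<Sum>t\<in>?T. \<gamma> t i a c * R t as cs X Y) = ?Z i (a # as) (c # cs) X Y"
        unfolding R_def P_def Q_def sum_index_words_Suc
        by (rule disjoint_product_scheme_eval[OF scheme i(1,2,4),
              where x = "\<lambda>j a b w. x j (a # as) (b # w) X Y" and
                y = "\<lambda>k b c w. y k (b # w) (c # cs) X Y"]) simp
    qed
    ultimately have "cost_le N ((\<lambda>t. R t as cs) ` ?T) (2 * card ?T) {?Z i (a # as) (c # cs)}"
      by (simp only:)
    moreover have "(\<lambda>t. R t as cs) ` ?T \<subseteq> ?R"
    proof (rule image_subsetI)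
      fix t assume "t \<in> ?T"
      then obtain t1 t2 where t: "t = (t1, t2)" "t1 < q" "t2 < s" by auto
      then have "R t as cs \<in> entry_set s ?I (\<lambda>j. R (t1, j))"
        using i entry_setI[of t2 s as ?I cs "\<lambda>j. R (t1, j)"] by simp
      then show "R t as cs \<in> ?R" using t(2) by (intro UN_I) simp_all
    qed
    ultimately have "cost_le N ?R (2 * (q * s)) {?Z i (a # as) (c # cs)}"
      by (rule cost_le_weaken) simp_all
    then show "cost_le N ?R (case r of (i, a, c) \<Rightarrow> 2 * (q * s)) (case r of (i, a, c) \<Rightarrow> {?Z i a c})"
      by (simp add: r)
  qed simp
  then have "cost_le N ?R (s * (n ^ Suc h * n ^ Suc h * (2 * (q * s))))
    (\<Union>(i, a, c)\<in>{..<s} \<times> ?J \<times> ?J. {?Z i a c})"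
    by (rule cost_le_weaken) (simp_all add: case_prod_unfold mult_ac)
  moreover have "entry_set s ?J ?Z \<subseteq> (\<Union>(i, a, c)\<in>{..<s} \<times> ?J \<times> ?J. {?Z i a c})"
    by (rule entry_set_subsetI) blast
  ultimately have Z: "cost_le N ?R (s * (n ^ Suc h * n ^ Suc h * (2 * (q * s)))) (entry_set s ?J ?Z)"
    by (blast intro: cost_le_weaken)
  have "cost_le N ?in (q * s * ((n\<^sup>2) ^ h * (4 * (s * n\<^sup>2))) + q * scheme_cost s n q h +
      s * (n ^ Suc h * n ^ Suc h * (2 * (q * s)))) (?PQ \<union> ?R \<union> entry_set s ?J ?Z)"
  proof (rule cost_le_trans[OF cost_le_trans[OF PQ R] Z])
    show "?PQ \<subseteq> ?in \<union> ?PQ \<union> const_funs" by (simp add: le_supI1)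
    show "?R \<subseteq> ?in \<union> (?PQ \<union> ?R) \<union> const_funs" by (rule le_supI1, rule le_supI2) simp
  qed
  then show ?case
    by (rule cost_le_weaken) (simp_all add: algebra_simps power2_eq_square power_mult_distrib)
qed

section \<open>The exponent\<close>

text \<open>The summand on the left strengthens the induction. Passing to \<open>Suc h\<close>
  multiplies it by \<open>n\<^sup>2\<close> and adds one further copy from the recurrence, and
  \<open>n\<^sup>2 + 1 \<le> q\<close> absorbs both.\<close>

lemma scheme_cost_le:
  assumes "n\<^sup>2 < q"
  shows "scheme_cost s n q h + 6 * q * s\<^sup>2 * n\<^sup>2 * (n\<^sup>2) ^ h \<le> (s + 6 * q * s\<^sup>2 * n\<^sup>2) * q ^ h"
proof (induction h)
  case (Suc h)
  let ?D = "6 * q * s\<^sup>2 * n\<^sup>2"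
  have "scheme_cost s n q (Suc h) + ?D * (n\<^sup>2) ^ Suc h = q * scheme_cost s n q h + (n\<^sup>2 + 1) * (?D * (n\<^sup>2) ^ h)"
    by (simp add: algebra_simps)
  also have "\<dots> \<le> q * scheme_cost s n q h + q * (?D * (n\<^sup>2) ^ h)"
    using assms by (intro add_left_mono mult_right_mono) simp_all
  also have "\<dots> = q * (scheme_cost s n q h + ?D * (n\<^sup>2) ^ h)"
    by (simp only: distrib_left)
  also have "\<dots> \<le> q * ((s + ?D) * q ^ h)"
    using Suc.IH by (rule mult_left_mono) simp
  finally show ?case by (simp add: mult_ac)
qed simp

text \<open>The inputs are padded with zeros to size \<open>n ^ h\<close> and used for all
  \<open>s\<close> products at once; only product 0 is read off. The waste is a factor that depends
  on \<open>s\<close> but not on \<open>N\<close>.\<close>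

lemma multiplies_matrices_of_scheme:
  assumes scheme: "disjoint_product_scheme s n q \<alpha> \<beta> \<gamma>" and s: "0 < s" and N: "N \<le> n ^ h"
  shows "\<exists>p. length p \<le> scheme_cost s n q h \<and> multiplies_matrices N p"
proof -
  let ?I = "index_words n h"
  obtain e where e: "bij_betw e ?I {0..<n ^ h}"
    using ex_bij_betw_finite_nat[of ?I] by auto
  define x :: "nat \<Rightarrow> nat list \<Rightarrow> nat list \<Rightarrow> entry_fun"
    where "x = (\<lambda>j a b X Y. if e a < N \<and> e b < N then X $$ (e a, e b) else 0)"
  define y :: "nat \<Rightarrow> nat list \<Rightarrow> nat list \<Rightarrow> entry_fun"
    where "y = (\<lambda>j a b X Y. if e a < N \<and> e b < N then Y $$ (e a, e b) else 0)"
  have const: "computes N [] (\<lambda>X Y. z)" for z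
    unfolding computes_def by (rule exI[of _ "Const z"]) simp
  have x: "computes N [] (x j a b)" for j a b
  proof (cases "e a < N \<and> e b < N")
    case True
    then show ?thesis
      unfolding computes_def x_def by (intro exI[of _ "LeftEntry (e a) (e b)"]) simp
  next
    case False
    then have "x j a b = (\<lambda>X Y. 0)" unfolding x_def by auto
    then show ?thesis using const by simp
  qed
  have y: "computes N [] (y j a b)" for j a b
  proof (cases "e a < N \<and> e b < N")
    case True
    then show ?thesis
      unfolding computes_def y_def by (intro exI[of _ "RightEntry (e a) (e b)"]) simp
  next
    case False
    then have "y j a b = (\<lambda>X Y. 0)" unfolding y_def by auto
    then show ?thesis using const by simp
  qed
  let ?z = "\<lambda>j a c X Y. \<Sum>b\<in>?I. x j a b X Y * y j b c X Y"
  have "(\<forall>z. computes N [] (\<lambda>X Y. z)) \<and> (\<forall>f\<in>entry_set s ?I x \<union> entry_set s ?I y. computes N [] f)"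
    using const x y unfolding entry_set_def by auto
  from cost_le_disjoint_products[OF scheme, unfolded cost_le_def, THEN spec, THEN mp, OF this]
  obtain p where p: "length p \<le> scheme_cost s n q h" and
    out: "\<And>f. f \<in> entry_set s ?I ?z \<Longrightarrow> computes N p f" and "computes N p (\<lambda>X Y. 0)"
    by auto
  then have run: "run X Y p [] \<noteq> None" if "X \<in> carrier_mat N N" "Y \<in> carrier_mat N N" for X Y
    using that unfolding computes_def by fastforce
  have prod: "\<exists>a. \<forall>X\<in>carrier_mat N N. \<forall>Y\<in>carrier_mat N N.
      \<exists>rs. run X Y p [] = Some rs \<and> operand_value X Y rs a = Some ((X * Y) $$ (i, j))"
    if ij: "i < N" "j < N" for i j
  proof -
    have preimage: "\<exists>a\<in>?I. e a = r" if "r < N" for r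
      using e that N bij_betw_imp_surj_on[OF e] by (metis atLeastLessThan_iff imageE le0 order_less_le_trans)
    from preimage[OF ij(1)] obtain a where a: "a \<in> ?I" "e a = i" ..
    from preimage[OF ij(2)] obtain c where c: "c \<in> ?I" "e c = j" ..
    note ac = a(1) c(1) a(2) c(2)
    have z: "?z 0 a c X Y = (X * Y) $$ (i, j)" if "X \<in> carrier_mat N N" "Y \<in> carrier_mat N N" for X Y
    proof -
      have "?z 0 a c X Y = (\<Sum>b\<in>?I. if e b < N then X $$ (i, e b) * Y $$ (e b, j) else 0)"
        using ij ac unfolding x_def y_def by (intro sum.cong) auto
      also have "\<dots> = (\<Sum>k\<in>{0..<n ^ h}. if k < N then X $$ (i, k) * Y $$ (k, j) else 0)"
        by (rule sum.reindex_bij_betw[OF e])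
      also have "\<dots> = (\<Sum>k\<in>{0..<N}. X $$ (i, k) * Y $$ (k, j))"
        using N by (intro sum.mono_neutral_cong_right) auto
      also have "\<dots> = (X * Y) $$ (i, j)"
        using that ij by (simp add: scalar_prod_def)
      finally show ?thesis .
    qed
    have "computes N p (?z 0 a c)"
      using out entry_setI[OF s ac(1,2), of ?z] by blast
    then obtain a' where a': "\<And>X Y. X \<in> carrier_mat N N \<Longrightarrow> Y \<in> carrier_mat N N \<Longrightarrow>
      \<exists>rs. run X Y p [] = Some rs \<and> operand_value X Y rs a' = Some (?z 0 a c X Y)"
      unfolding computes_def by blast
    show ?thesis
    proof (intro exI[of _ a'] ballI)
      fix X Y :: "complex mat" assume XY: "X \<in> carrier_mat N N" "Y \<in> carrier_mat N N"
      show "\<exists>rs. run X Y p [] = Some rs \<and> operand_value X Y rs a' = Some ((X * Y) $$ (i, j))"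
        using a'[OF XY] unfolding z[OF XY] .
    qed
  qed
  then obtain o' where o': "\<And>i j X Y. i < N \<Longrightarrow> j < N \<Longrightarrow> X \<in> carrier_mat N N \<Longrightarrow>
      Y \<in> carrier_mat N N \<Longrightarrow>
      \<exists>rs. run X Y p [] = Some rs \<and> operand_value X Y rs (o' i j) = Some ((X * Y) $$ (i, j))"
    by metis
  have "multiplies_matrices N p"
    unfolding multiplies_matrices_def
  proof (intro exI[of _ o'] ballI)
    fix X Y :: "complex mat" assume XY: "X \<in> carrier_mat N N" "Y \<in> carrier_mat N N"
    show "\<exists>rs. run X Y p [] = Some rs \<and>
      (\<forall>i<N. \<forall>j<N. operand_value X Y rs (o' i j) = Some ((X * Y) $$ (i, j)))"
    proof -
      obtain rs where "run X Y p [] = Some rs" using run[OF XY] by blast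
      then show ?thesis using o'[OF _ _ XY] by fastforce
    qed
  qed
  then show ?thesis using p by blast
qed

text \<open>For the least depth \<open>h\<close> with \<open>N \<le> n ^ h\<close>, the power
  \<open>q ^ (h - 1)\<close> equals \<open>n ^ (h - 1)\<close> raised to \<open>log n q\<close>,
  hence is at most \<open>N powr log n q\<close>. The remaining factor \<open>q\<close> is a
  constant.\<close>

lemma matmul_in_time_of_scheme:
  assumes scheme: "disjoint_product_scheme s n q \<alpha> \<beta> \<gamma>" and s: "0 < s" and n: "2 \<le> n"
    and q: "n\<^sup>2 < q"
  shows "matmul_in_time (\<lambda>N. real N powr log n q)"
proof -
  define h where "h = (\<lambda>N. LEAST h. N \<le> n ^ h)"
  have ex: "\<exists>h. N \<le> n ^ h" for N
    using n less_exp[of N] power_mono[of 2 n N] by (intro exI[of _ N]) linarith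
  have h: "N \<le> n ^ h N" for N
    unfolding h_def using ex by (rule LeastI_ex)
  obtain P where P: "\<And>N. length (P N) \<le> scheme_cost s n q (h N)" "\<And>N. multiplies_matrices N (P N)"
    using multiplies_matrices_of_scheme[OF scheme s h] by metis
  let ?D = "s + 6 * q * s\<^sup>2 * n\<^sup>2"
  have "real (length (P N)) \<le> real (?D * q) * real N powr log n q" if N: "2 \<le> N" for N
  proof -
    have "h N \<noteq> 0" using h[of N] N by (cases "h N = 0") auto
    then have "\<not> N \<le> n ^ (h N - 1)"
      unfolding h_def using not_less_Least[of "(LEAST h. N \<le> n ^ h) - 1" "\<lambda>h. N \<le> n ^ h"] by simp
    then have "n ^ (h N - 1) \<le> N" by simp
    have "real q ^ (h N - 1) = (real n powr log n q) ^ (h N - 1)"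
      using n q by simp
    also have "\<dots> = real (n ^ (h N - 1)) powr log n q"
      using n by (simp add: powr_powr powr_realpow[symmetric] mult.commute)
    also have "\<dots> \<le> real N powr log n q"
      using \<open>n ^ (h N - 1) \<le> N\<close> n q by (intro powr_mono2) (simp_all add: le_log_iff flip: of_nat_power)
    finally have "real q ^ h N \<le> q * real N powr log n q"
      using \<open>h N \<noteq> 0\<close> by (cases "h N") (simp_all add: mult_left_mono)
    moreover have "length (P N) \<le> ?D * q ^ h N"
      using P(1)[of N] scheme_cost_le[OF q, of s "h N"] by linarith
    then have "real (length (P N)) \<le> real ?D * real q ^ h N"
      by (metis of_nat_le_iff of_nat_mult of_nat_power)
    moreover have "real ?D * real q ^ h N \<le> real ?D * (q * real N powr log n q)"
      using calculation by (intro mult_left_mono) simp_all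
    ultimately have "real (length (P N)) \<le> real ?D * (q * real N powr log n q)"
      by linarith
    then show ?thesis by (simp only: of_nat_mult mult.assoc)
  qed
  then have "(\<lambda>N. real (length (P N))) \<in> O(\<lambda>N. real N powr log n q)"
    by (intro bigoI[where c = "real (?D * q)"] eventually_sequentiallyI[of 2]) simp
  then show ?thesis
    unfolding matmul_in_time_def using P(2) by blast
qed

section \<open>The exponent as an attained minimum\<close>

text \<open>Without instructions, an output is a constant or an input entry. The product of identity
  matrices excludes the constant 0, and the two products of a zero matrix with the all-ones matrix
  exclude everything else.\<close>

lemma not_multiplies_matrices_Nil:
  assumes "0 < n"
  shows "\<not> multiplies_matrices n []"
proof
  assume "multiplies_matrices n []"
  then obtain a where a: "\<And>X Y. X \<in> carrier_mat n n \<Longrightarrow> Y \<in> carrier_mat n n \<Longrightarrow>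
      operand_value X Y [] a = Some ((X * Y) $$ (0, 0))"
    unfolding multiplies_matrices_def using assms by (metis option.inject run.simps(1))
  let ?J = "mat n n (\<lambda>_. 1 :: complex)"
  have "(1\<^sub>m n * 1\<^sub>m n :: complex mat) $$ (0, 0) = 1" "(0\<^sub>m n n * ?J) $$ (0, 0) = 0"
    "(?J * 0\<^sub>m n n) $$ (0, 0) = 0"
    using assms by auto
  then show False
    using a[of "1\<^sub>m n" "1\<^sub>m n"] a[of "0\<^sub>m n n" ?J] a[of ?J "0\<^sub>m n n"]
    by (cases a) (auto split: if_splits)
qed

text \<open>A negative exponent would force the program lengths below 1, so almost all programs
  would be empty. This crude lower bound suffices to make the infimum of the admissible exponents
  meaningful.\<close>

lemma matmul_in_time_exponent_nonneg:
  assumes "matmul_in_time (\<lambda>n. real n powr w)"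
  shows "0 \<le> w"
proof (rule ccontr)
  assume "\<not> 0 \<le> w"
  obtain P where P: "\<And>n. multiplies_matrices n (P n)" "(\<lambda>n. real (length (P n))) \<in> O(\<lambda>n. real n powr w)"
    using assms unfolding matmul_in_time_def by blast
  have "(\<lambda>n. real n powr w) \<in> o(\<lambda>_. 1)"
    using \<open>\<not> 0 \<le> w\<close> by (intro smalloI_tendsto) (simp_all add: tendsto_neg_powr filterlim_real_sequentially)
  with P(2) have "(\<lambda>n. real (length (P n))) \<in> o(\<lambda>_. 1)"
    by (rule landau_o.big_small_trans)
  then have "(\<lambda>n. real (length (P n))) \<longlonglongrightarrow> 0"
    by (auto dest: smalloD_tendsto)
  then have "\<forall>\<^sub>F n in sequentially. real (length (P n)) < 1"
    by (rule order_tendstoD) simp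
  then obtain m where "\<And>n. m \<le> n \<Longrightarrow> real (length (P n)) < 1"
    unfolding eventually_sequentially by blast
  from this[of "Suc m"] obtain n where "0 < n" "P n = []"
    by force
  then show False
    using P(1)[of n] not_multiplies_matrices_Nil by simp
qed

lemma matmul_in_time_mono:
  assumes "matmul_in_time (\<lambda>n. real n powr v)" "v \<le> w"
  shows "matmul_in_time (\<lambda>n. real n powr w)"
proof -
  have "(\<lambda>n. real n powr v) \<in> O(\<lambda>n. real n powr w)"
    using assms(2) by (intro bigoI[where c = 1] eventually_sequentiallyI[of 1]) (auto intro: powr_mono)
  then show ?thesis
    using assms(1) landau_o.big_trans unfolding matmul_in_time_def by blast
qed

text \<open>\<open>LEAST\<close> over the reals says something only if a minimum exists. The
  \<epsilon> in the definition makes the set of admissible exponents contain its infimum, so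
  \<open>matmul_exponent\<close> is that infimum.\<close>

lemma matmul_exponent_le:
  assumes "matmul_in_time (\<lambda>n. real n powr v)"
  shows "matmul_exponent \<le> v"
proof -
  define W where "W = {w. \<forall>\<epsilon>>0. matmul_in_time (\<lambda>n. real n powr (w + \<epsilon>))}"
  have W: "w \<in> W \<longleftrightarrow> (\<forall>\<epsilon>>0. matmul_in_time (\<lambda>n. real n powr (w + \<epsilon>)))" for w
    unfolding W_def by simp
  have v: "v \<in> W"
    unfolding W using matmul_in_time_mono[OF assms] by simp
  have lower: "0 \<le> w" if "w \<in> W" for w
  proof (rule ccontr)
    assume "\<not> 0 \<le> w"
    with that[unfolded W, THEN spec, of "- w / 2"] have "matmul_in_time (\<lambda>n. real n powr (w / 2))"
      by (simp add: field_simps)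
    from matmul_in_time_exponent_nonneg[OF this] \<open>\<not> 0 \<le> w\<close> show False by simp
  qed
  have bdd: "bdd_below W" using lower by (rule bdd_belowI)
  have "matmul_in_time (\<lambda>n. real n powr (Inf W + \<epsilon>))" if "0 < \<epsilon>" for \<epsilon>
  proof -
    have "\<exists>w\<in>W. w < Inf W + \<epsilon> / 2"
      using v that by (intro cInf_lessD) auto
    then obtain w where w: "w \<in> W" "w < Inf W + \<epsilon> / 2" ..
    then have "matmul_in_time (\<lambda>n. real n powr (w + \<epsilon> / 2))"
      using that unfolding W by simp
    then show ?thesis
      by (rule matmul_in_time_mono) (use w in simp)
  qed
  then have "Inf W \<in> W"
    unfolding W by blast
  have "matmul_exponent = (LEAST w. w \<in> W)"
    unfolding matmul_exponent_def W ..
  also have "\<dots> = Inf W"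
    using \<open>Inf W \<in> W\<close> bdd by (intro Least_equality cInf_lower)
  finally show ?thesis
    using cInf_lower[OF v bdd] by simp
qed

section \<open>From the simultaneous triple product property to bilinear schemes\<close>

text \<open>The characters of the group, evaluated at arbitrary integer vectors instead of reduced
  representatives. Sums and differences therefore need no reduction modulo \<open>l\<close>.\<close>

definition character :: "nat \<Rightarrow> 'i set \<Rightarrow> ('i \<Rightarrow> int) \<Rightarrow> ('i \<Rightarrow> int) \<Rightarrow> complex" where
  "character l I \<xi> x = (\<Prod>i\<in>I. cis (2 * pi * real_of_int (\<xi> i * x i) / real l))"

lemma character_add:
  "character l I \<xi> (\<lambda>i. x i + y i) = character l I \<xi> x * character l I \<xi> y"
  unfolding character_def prod.distrib[symmetric]
  by (intro prod.cong refl) (simp add: cis_mult algebra_simps add_divide_distrib)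

lemma sum_roots_of_unity:
  assumes "0 < l"
  shows "(\<Sum>r\<in>{0..<int l}. cis (2 * pi * real_of_int (r * x) / real l)) =
    (if int l dvd x then of_nat l else 0)"
proof -
  define z where "z = cis (2 * pi * real_of_int x / real l)"
  have "{0..<int l} = int ` {..<l}"
    by (simp add: image_int_atLeastLessThan lessThan_atLeast0)
  then have "(\<Sum>r\<in>{0..<int l}. cis (2 * pi * real_of_int (r * x) / real l)) = (\<Sum>r<l. z ^ r)"
    by (simp add: sum.reindex z_def DeMoivre mult_ac)
  also have "\<dots> = (if int l dvd x then of_nat l else 0)"
  proof (cases "int l dvd x")
    case True
    then obtain m where "x = int l * m" ..
    then have "z = 1" using assms unfolding z_def cis_eq_1_iff by (auto intro!: exI[of _ m])
    then show ?thesis using True by simp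
  next
    case False
    have "z \<noteq> 1"
    proof
      assume "z = 1"
      then obtain m :: int where "2 * pi * real_of_int x / real l = of_int m * (2 * pi)"
        unfolding z_def cis_eq_1_iff by blast
      then have "real_of_int x = real_of_int (int l * m)"
        using assms by (simp add: field_simps)
      then have "x = int l * m" by linarith
      then show False using False by simp
    qed
    moreover have "z ^ l = 1"
      using assms cis_multiple_2pi[of "real_of_int x"] by (simp add: z_def DeMoivre)
    ultimately show ?thesis using False by (simp add: geometric_sum)
  qed
  finally show ?thesis .
qed

lemma sum_characters:
  assumes "0 < l" "finite I"
  shows "(\<Sum>\<xi>\<in>(I \<rightarrow>\<^sub>E {0..<int l}). character l I \<xi> x) =
    (if \<forall>i\<in>I. int l dvd x i then of_nat l ^ card I else 0)"
proof -
  have "(\<Sum>\<xi>\<in>(I \<rightarrow>\<^sub>E {0..<int l}). character l I \<xi> x) =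
    (\<Prod>i\<in>I. \<Sum>r\<in>{0..<int l}. cis (2 * pi * real_of_int (r * x i) / real l))"
    unfolding character_def by (rule prod_sum_PiE[symmetric]) (simp_all add: assms)
  also have "\<dots> = (\<Prod>i\<in>I. if int l dvd x i then of_nat l else 0)"
    using sum_roots_of_unity[OF assms(1)] by simp
  also have "\<dots> = (if \<forall>i\<in>I. int l dvd x i then of_nat l ^ card I else 0)"
    using assms(2) by (auto simp: prod_zero_iff)
  finally show ?thesis .
qed

section \<open>Arithmetic in powers of cyclic groups\<close>

definition Cyc_product :: "nat \<Rightarrow> 'i set \<Rightarrow> ('i \<Rightarrow> int) monoid" where
  "Cyc_product l I = product_group I (\<lambda>_. Cyc l)"

lemma carrier_Cyc_product: "0 < l \<Longrightarrow> carrier (Cyc_product l I) = I \<rightarrow>\<^sub>E {0..<int l}"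
  by (simp add: carrier_integer_mod_group Cyc_product_def)

lemma card_carrier_Cyc_product:
  "0 < l \<Longrightarrow> finite I \<Longrightarrow> card (carrier (Cyc_product l I)) = l ^ card I"
  by (simp add: carrier_Cyc_product card_PiE)

lemma one_Cyc_product: "\<one>\<^bsub>Cyc_product l I\<^esub> = (\<lambda>i\<in>I. 0)"
  by (simp add: Cyc_product_def)

lemma mult_Cyc_product: "x \<otimes>\<^bsub>Cyc_product l I\<^esub> y = (\<lambda>i\<in>I. (x i + y i) mod int l)"
  by (simp add: Cyc_product_def)

lemma inv_Cyc_product:
  assumes "x \<in> carrier (Cyc_product l I)"
  shows "inv\<^bsub>Cyc_product l I\<^esub> x = (\<lambda>i\<in>I. (- x i) mod int l)"
proof -
  have "inv\<^bsub>Cyc_product l I\<^esub> x = (\<lambda>i\<in>I. inv\<^bsub>Cyc l\<^esub> (x i))"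
    using assms unfolding Cyc_product_def by (intro inv_product_group) simp_all
  also have "\<dots> = (\<lambda>i\<in>I. (- x i) mod int l)"
    using assms unfolding Cyc_product_def by (intro restrict_ext inv_integer_mod_group) auto
  finally show ?thesis .
qed

lemma restrict_eq_restrict_iff:
  "(\<lambda>i\<in>I. f i) = (\<lambda>i\<in>I. g i) \<longleftrightarrow> (\<forall>i\<in>I. f i = g i)"
  by (auto simp: restrict_def fun_eq_iff)

lemma Cyc_product_word_eq_one:
  assumes "a' \<in> carrier (Cyc_product l I)" "b' \<in> carrier (Cyc_product l I)"
    "c' \<in> carrier (Cyc_product l I)"
  shows "a \<otimes>\<^bsub>Cyc_product l I\<^esub> inv\<^bsub>Cyc_product l I\<^esub> a' \<otimes>\<^bsub>Cyc_product l I\<^esub> b \<otimes>\<^bsub>Cyc_product l I\<^esub>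
      inv\<^bsub>Cyc_product l I\<^esub> b' \<otimes>\<^bsub>Cyc_product l I\<^esub> c \<otimes>\<^bsub>Cyc_product l I\<^esub> inv\<^bsub>Cyc_product l I\<^esub> c' =
      \<one>\<^bsub>Cyc_product l I\<^esub> \<longleftrightarrow>
    (\<forall>i\<in>I. int l dvd a i - a' i + b i - b' i + c i - c' i)"
  unfolding inv_Cyc_product[OF assms(1)] inv_Cyc_product[OF assms(2)]
    inv_Cyc_product[OF assms(3)] mult_Cyc_product one_Cyc_product restrict_eq_restrict_iff
  by (intro ball_cong refl) (simp add: mod_simps mod_eq_0_iff_dvd)

text \<open>The bracketing of the triple product property, as opposed to that of the simultaneous
  property in \<open>Cyc_product_word_eq_one\<close>; both become the same divisibility
  condition.\<close>

lemma Cyc_product_quotients_eq_one: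
  assumes "a' \<in> carrier (Cyc_product l I)" "b' \<in> carrier (Cyc_product l I)"
    "c' \<in> carrier (Cyc_product l I)"
  shows "(a \<otimes>\<^bsub>Cyc_product l I\<^esub> inv\<^bsub>Cyc_product l I\<^esub> a') \<otimes>\<^bsub>Cyc_product l I\<^esub> (b \<otimes>\<^bsub>Cyc_product l I\<^esub>
      inv\<^bsub>Cyc_product l I\<^esub> b') \<otimes>\<^bsub>Cyc_product l I\<^esub> (c \<otimes>\<^bsub>Cyc_product l I\<^esub> inv\<^bsub>Cyc_product l I\<^esub> c') =
      \<one>\<^bsub>Cyc_product l I\<^esub> \<longleftrightarrow>
    (\<forall>i\<in>I. int l dvd a i - a' i + b i - b' i + c i - c' i)"
  unfolding inv_Cyc_product[OF assms(1)] inv_Cyc_product[OF assms(2)]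
    inv_Cyc_product[OF assms(3)] mult_Cyc_product one_Cyc_product restrict_eq_restrict_iff
  by (intro ball_cong refl) (simp add: mod_simps, simp add: algebra_simps mod_eq_0_iff_dvd)

lemma Cyc_product_quotient_eq_one:
  assumes "a \<in> carrier (Cyc_product l I)" "a' \<in> carrier (Cyc_product l I)"
  shows "a \<otimes>\<^bsub>Cyc_product l I\<^esub> inv\<^bsub>Cyc_product l I\<^esub> a' = \<one>\<^bsub>Cyc_product l I\<^esub> \<longleftrightarrow> a = a'"
proof -
  interpret group "Cyc_product l I" unfolding Cyc_product_def by simp
  show ?thesis
    using assms by (metis inv_closed inv_equality inv_inv r_inv)
qed

text \<open>The simultaneous condition first forces the three indices to agree; then the triple
  product property of that one index forces the elements to agree.\<close>

lemma STPP_iff: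
  assumes "simultaneous_triple_product_property (Cyc_product l I) U A B C"
    and "u \<in> U" "v \<in> U" "w \<in> U" and "a \<in> A u" "a' \<in> A v" "b \<in> B v" "b' \<in> B w" "c \<in> C w" "c' \<in> C u"
  shows "(\<forall>i\<in>I. int l dvd a i - a' i + b i - b' i + c i - c' i) \<longleftrightarrow>
    u = v \<and> v = w \<and> a = a' \<and> b = b' \<and> c = c'"
proof
  let ?G = "Cyc_product l I"
  have tpp: "triple_product_property ?G (A x) (B x) (C x)" if "x \<in> U" for x
    using assms(1) that unfolding simultaneous_triple_product_property_def by blast
  then have sub: "A x \<subseteq> carrier ?G" "B x \<subseteq> carrier ?G" "C x \<subseteq> carrier ?G" if "x \<in> U" for x
    using that unfolding triple_product_property_def by blast+
  have carr: "a \<in> carrier ?G" "a' \<in> carrier ?G" "b \<in> carrier ?G" "b' \<in> carrier ?G"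
    "c \<in> carrier ?G" "c' \<in> carrier ?G"
    using assms sub by blast+
  assume dvd: "\<forall>i\<in>I. int l dvd a i - a' i + b i - b' i + c i - c' i"
  then have one: "a \<otimes>\<^bsub>?G\<^esub> inv\<^bsub>?G\<^esub> a' \<otimes>\<^bsub>?G\<^esub> b \<otimes>\<^bsub>?G\<^esub> inv\<^bsub>?G\<^esub> b' \<otimes>\<^bsub>?G\<^esub> c \<otimes>\<^bsub>?G\<^esub> inv\<^bsub>?G\<^esub> c' = \<one>\<^bsub>?G\<^esub>"
    using Cyc_product_word_eq_one[OF carr(2,4,6)] by blast
  have uvw: "u = v \<and> v = w"
    using assms(1)[unfolded simultaneous_triple_product_property_def, THEN conjunct2, THEN bspec, OF assms(2), THEN bspec, OF assms(3), THEN bspec, OF assms(4),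
        THEN bspec, OF assms(5), THEN bspec, OF assms(6), THEN bspec, OF assms(7),
        THEN bspec, OF assms(8), THEN bspec, OF assms(9), THEN bspec, OF assms(10),
        THEN mp, OF one] .
  then have "a \<otimes>\<^bsub>?G\<^esub> inv\<^bsub>?G\<^esub> a' \<in> quotient_set ?G (A u)" "b \<otimes>\<^bsub>?G\<^esub> inv\<^bsub>?G\<^esub> b' \<in> quotient_set ?G (B u)"
    "c \<otimes>\<^bsub>?G\<^esub> inv\<^bsub>?G\<^esub> c' \<in> quotient_set ?G (C u)"
    using assms unfolding quotient_set_def by blast+
  with tpp[OF assms(2)] Cyc_product_quotients_eq_one[OF carr(2,4,6)] dvd
  have "a \<otimes>\<^bsub>?G\<^esub> inv\<^bsub>?G\<^esub> a' = \<one>\<^bsub>?G\<^esub> \<and> b \<otimes>\<^bsub>?G\<^esub> inv\<^bsub>?G\<^esub> b' = \<one>\<^bsub>?G\<^esub> \<and> c \<otimes>\<^bsub>?G\<^esub> inv\<^bsub>?G\<^esub> c' = \<one>\<^bsub>?G\<^esub>"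
    unfolding triple_product_property_def by blast
  then show "u = v \<and> v = w \<and> a = a' \<and> b = b' \<and> c = c'"
    using uvw Cyc_product_quotient_eq_one carr by blast
qed simp

text \<open>With a character \<chi> for each product, the coefficients are \<chi>(b - a'), \<chi>(c
  - b') and \<chi>(a - c') divided by the group order. Their product is \<chi> at the alternating
  sum of \<open>STPP_iff\<close>, and orthogonality of characters detects when that sum
  vanishes.\<close>

lemma scheme_of_STPP:
  assumes l: "0 < l" and I: "finite I" and stpp: "simultaneous_triple_product_property (Cyc_product l I) U A B C"
    and U: "finite U" "card U = s"
    and card: "\<And>u. u \<in> U \<Longrightarrow> card (A u) = n" "\<And>u. u \<in> U \<Longrightarrow> card (B u) = n"
      "\<And>u. u \<in> U \<Longrightarrow> card (C u) = n"
    and q: "l ^ card I \<le> q * s"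
  shows "\<exists>\<alpha> \<beta> \<gamma>. disjoint_product_scheme s n q \<alpha> \<beta> \<gamma>"
proof -
  let ?G = "I \<rightarrow>\<^sub>E {0..<int l}" and ?T = "{..<q} \<times> {..<s}"
  have finG: "finite ?G" and cardG: "card ?G = l ^ card I"
    using I by (simp_all add: finite_PiE card_PiE)
  obtain f where f: "bij_betw f {0..<s} U"
    using ex_bij_betw_nat_finite[OF U(1)] U(2) by blast
  have f_in: "f j \<in> U" if "j < s" for j
    using f that bij_betwE by fastforce
  have f_eq: "f i = f j \<longleftrightarrow> i = j" if "i < s" "j < s" for i j
    using f that unfolding bij_betw_def by (auto dest: inj_onD)
  have enum: "\<exists>e. \<forall>u\<in>U. bij_betw (e u) {0..<n} (S u)"
    if S: "\<And>u. u \<in> U \<Longrightarrow> S u \<subseteq> carrier (Cyc_product l I)" "\<And>u. u \<in> U \<Longrightarrow> card (S u) = n" for S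
  proof -
    have "finite (S u)" if "u \<in> U" for u
      using S(1)[OF that] finG finite_subset unfolding carrier_Cyc_product[OF l] by blast
    then have "\<exists>h. bij_betw h {0..<n} (S u)" if "u \<in> U" for u
      using ex_bij_betw_nat_finite[of "S u"] S(2) that by simp
    then show ?thesis by metis
  qed
  have "triple_product_property (Cyc_product l I) (A u) (B u) (C u)" if "u \<in> U" for u
    using stpp that unfolding simultaneous_triple_product_property_def by blast
  then have sub: "A u \<subseteq> carrier (Cyc_product l I)" "B u \<subseteq> carrier (Cyc_product l I)"
    "C u \<subseteq> carrier (Cyc_product l I)" if "u \<in> U" for u
    using that unfolding triple_product_property_def by blast+
  obtain eA where eA: "\<And>u. u \<in> U \<Longrightarrow> bij_betw (eA u) {0..<n} (A u)"
    using enum[of A] sub(1) card(1) by blast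
  obtain eB where eB: "\<And>u. u \<in> U \<Longrightarrow> bij_betw (eB u) {0..<n} (B u)"
    using enum[of B] sub(2) card(2) by blast
  obtain eC where eC: "\<And>u. u \<in> U \<Longrightarrow> bij_betw (eC u) {0..<n} (C u)"
    using enum[of C] sub(3) card(3) by blast
  have e_in: "e a \<in> M" if "bij_betw e {0..<n} M" "a < n" for e and M :: "('a \<Rightarrow> int) set" and a
    using that bij_betwE by fastforce
  have e_eq: "e a = e a' \<longleftrightarrow> a = a'" if "bij_betw e {0..<n} M" "a < n" "a' < n"
    for e and M :: "('a \<Rightarrow> int) set" and a a'
    using that unfolding bij_betw_def by (auto dest: inj_onD)
  \<comment> \<open>There are \<open>l ^ card I\<close> characters but \<open>q * s\<close> product
    slots. The slots outside the image of \<open>g\<close> are filled with zero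
    coefficients.\<close>
  obtain g where g: "g ` ?G \<subseteq> ?T" "inj_on g ?G"
    using card_le_inj[OF finG, of ?T] q cardG by (auto simp: card_cartesian_product)
  define coeff where "coeff = (\<lambda>t x. if t \<in> g ` ?G then character l I (inv_into ?G g t) x else 0)"
  define \<alpha> where "\<alpha> = (\<lambda>t j a b. coeff t (\<lambda>i. eB (f j) b i - eA (f j) a i))"
  define \<beta> where "\<beta> = (\<lambda>t j b c. coeff t (\<lambda>i. eC (f j) c i - eB (f j) b i))"
  define \<gamma> where "\<gamma> = (\<lambda>t j a c. coeff t (\<lambda>i. eA (f j) a i - eC (f j) c i) / of_nat l ^ card I)"
  have "(\<Sum>t\<in>?T. \<alpha> t j a' b * \<beta> t r b' c * \<gamma> t i a c') =
      (if i = j \<and> j = r \<and> a = a' \<and> b = b' \<and> c = c' then 1 else 0)"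
    if ijr: "i < s" "j < s" "r < s" and n: "a < n" "a' < n" "b < n" "b' < n" "c < n" "c' < n"
    for i j r a a' b b' c c'
  proof -
    define x where "x = (\<lambda>m. eA (f i) a m - eA (f j) a' m + eB (f j) b m - eB (f r) b' m + eC (f r) c m - eC (f i) c' m)"
    have x: "x = (\<lambda>m. (eB (f j) b m - eA (f j) a' m) + ((eC (f r) c m - eB (f r) b' m) + (eA (f i) a m - eC (f i) c' m)))"
      unfolding x_def by (simp add: algebra_simps)
    have "(\<forall>m\<in>I. int l dvd x m) \<longleftrightarrow> f i = f j \<and> f j = f r \<and>
        eA (f i) a = eA (f j) a' \<and> eB (f j) b = eB (f r) b' \<and> eC (f r) c = eC (f i) c'"
      unfolding x_def using ijr n
      by (intro STPP_iff[OF stpp] e_in[OF eA] e_in[OF eB] e_in[OF eC] f_in)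
    also have "\<dots> \<longleftrightarrow> i = j \<and> j = r \<and> a = a' \<and> b = b' \<and> c = c'"
      using f_eq[OF ijr(1,2)] f_eq[OF ijr(2,3)] e_eq[OF eA[OF f_in[OF ijr(1)]] n(1,2)]
        e_eq[OF eB[OF f_in[OF ijr(2)]] n(3,4)] e_eq[OF eC[OF f_in[OF ijr(3)]] n(5,6)] by metis
    finally have iff: "(\<forall>m\<in>I. int l dvd x m) \<longleftrightarrow> i = j \<and> j = r \<and> a = a' \<and> b = b' \<and> c = c'" .
    have "(\<Sum>t\<in>?T. \<alpha> t j a' b * \<beta> t r b' c * \<gamma> t i a c') =
        (\<Sum>t\<in>g ` ?G. \<alpha> t j a' b * \<beta> t r b' c * \<gamma> t i a c')"
      using g(1) by (intro sum.mono_neutral_right) (simp_all add: \<alpha>_def coeff_def)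
    also have "\<dots> = (\<Sum>\<xi>\<in>?G. character l I \<xi> x / of_nat l ^ card I)"
      unfolding sum.reindex[OF g(2)] x character_add
      by (intro sum.cong refl)
        (simp add: \<alpha>_def \<beta>_def \<gamma>_def coeff_def inv_into_f_f[OF g(2)])
    also have "\<dots> = (if \<forall>m\<in>I. int l dvd x m then 1 else 0)"
      using l I by (simp add: sum_characters flip: sum_divide_distrib)
    also have "\<dots> = (if i = j \<and> j = r \<and> a = a' \<and> b = b' \<and> c = c' then 1 else 0)"
      unfolding iff ..
    finally show ?thesis .
  qed
  then have "disjoint_product_scheme s n q \<alpha> \<beta> \<gamma>"
    unfolding disjoint_product_scheme_def by simp
  then show ?thesis by blast
qed

section \<open>Local USPs\<close>

lemma Cyc_power_eq: "Cyc_power l k = Cyc_product l {1..k}"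
  by (simp add: Cyc_product_def)

section \<open>Integer representatives of the sets attached to the symbols\<close>

lemma H_hat_eq:
  assumes "0 < l"
  shows "H_hat l = {2..<int l}"
  using assms by (auto simp: H_hat_def carrier_integer_mod_group)

lemma A_set_simps:
  assumes "0 < l"
  shows "A_set l (Suc 0) = {0}" "A_set l 2 = {1}" "A_set l 3 = {2..<int l}"
  using H_hat_eq[OF assms] by (simp_all add: A_set_def)

lemma B_set_simps:
  assumes "0 < l"
  shows "B_set l (Suc 0) = {1..int l - 2}" "B_set l 2 = {0}" "B_set l 3 = {0}"
proof -
  have "B_set l (Suc 0) = (\<lambda>h. inv\<^bsub>Cyc l\<^esub> h) ` {2..<int l}"
    using H_hat_eq[OF assms] by (simp add: B_set_def)
  also have "\<dots> = (\<lambda>h. int l - h) ` {2..<int l}"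
  proof (rule image_cong[OF refl])
    fix h assume h: "h \<in> {2..<int l}"
    then have "inv\<^bsub>Cyc l\<^esub> h = (- h) mod int l"
      using assms by (intro inv_integer_mod_group) (simp add: carrier_integer_mod_group)
    also have "\<dots> = int l - h"
      using h by (simp add: zmod_zminus1_eq_if)
    finally show "inv\<^bsub>Cyc l\<^esub> h = int l - h" .
  qed
  also have "\<dots> = {1..int l - 2}"
  proof (intro equalityI subsetI)
    fix x assume "x \<in> {1..int l - 2}"
    then show "x \<in> (\<lambda>h. int l - h) ` {2..<int l}"
      by (intro image_eqI[of _ _ "int l - x"]) auto
  qed auto
  finally show "B_set l (Suc 0) = {1..int l - 2}" .
qed (simp_all add: B_set_def)

lemma C_set_simps:
  assumes "0 < l"
  shows "C_set l (Suc 0) = {0}" "C_set l 2 = {2..<int l}" "C_set l 3 = {0}"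
  using H_hat_eq[OF assms] by (simp_all add: C_set_def)

lemma A_prod_mem: "x \<in> A_prod l k u \<Longrightarrow> i \<in> {1..k} \<Longrightarrow> x i \<in> A_set l (u i)"
  unfolding A_prod_def by (rule PiE_mem)

lemma B_prod_mem: "x \<in> B_prod l k u \<Longrightarrow> i \<in> {1..k} \<Longrightarrow> x i \<in> B_set l (u i)"
  unfolding B_prod_def by (rule PiE_mem)

lemma C_prod_mem: "x \<in> C_prod l k u \<Longrightarrow> i \<in> {1..k} \<Longrightarrow> x i \<in> C_set l (u i)"
  unfolding C_prod_def by (rule PiE_mem)

lemma symbol_sets_subset:
  assumes "3 \<le> l" "s \<in> {1, 2, 3}"
  shows "A_set l s \<subseteq> {0..<int l}" "B_set l s \<subseteq> {0..<int l}" "C_set l s \<subseteq> {0..<int l}"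
proof -
  have "0 < l" using assms(1) by simp
  note sets = A_set_simps[OF this] B_set_simps[OF this] C_set_simps[OF this]
  show "A_set l s \<subseteq> {0..<int l}" "B_set l s \<subseteq> {0..<int l}" "C_set l s \<subseteq> {0..<int l}"
    using assms by (elim insertE emptyE; simp add: sets subset_iff)+
qed

lemma dvd_bounded_imp_eq_0:
  fixes x m :: int
  assumes "m dvd x" "\<bar>x\<bar> < m"
  shows "x = 0"
proof (rule ccontr)
  assume "x \<noteq> 0"
  from dvd_imp_le_int[OF this assms(1)] assms(2) show False by linarith
qed

text \<open>For each symbol only one of the three sets has more than one possible element, so the
  alternating sum is, up to sign, a difference of two representatives and smaller than
  \<open>l\<close> in absolute value.\<close>

lemma symbol_sets_TPP:
  assumes l: "3 \<le> l" and s: "s \<in> {1, 2, 3}"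
    and mem: "a \<in> A_set l s" "a' \<in> A_set l s" "b \<in> B_set l s" "b' \<in> B_set l s" "c \<in> C_set l s" "c' \<in> C_set l s"
    and dvd: "int l dvd a - a' + b - b' + c - c'"
  shows "a = a' \<and> b = b' \<and> c = c'"
proof -
  have "0 < l" using l by simp
  note sets = A_set_simps[OF this] B_set_simps[OF this] C_set_simps[OF this]
  have "a - a' + b - b' + c - c' = 0"
    using s mem by (intro dvd_bounded_imp_eq_0[OF dvd]) (auto simp: sets)
  then show ?thesis
    using s mem by (auto simp: sets)
qed

text \<open>In the order listed, the sum is -1 - b', c - 1, b, -a', -c', a - 1 and -1. As
  \<open>H_hat\<close> omits 0 and 1, none of these vanishes, and all lie strictly between -l and
  l.\<close>

lemma symbol_sets_USP:
  assumes l: "3 \<le> l"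
    and x: "(x, y, z) \<in> {(1,2,1), (1,2,2), (1,1,3), (1,3,3), (2,2,3), (3,2,3), (1,2,3)}"
    and mem: "a \<in> A_set l x" "a' \<in> A_set l y" "b \<in> B_set l y" "b' \<in> B_set l z" "c \<in> C_set l z" "c' \<in> C_set l x"
  shows "\<not> int l dvd a - a' + b - b' + c - c'"
proof
  assume dvd: "int l dvd a - a' + b - b' + c - c'"
  have "0 < l" using l by simp
  note sets = A_set_simps[OF this] B_set_simps[OF this] C_set_simps[OF this]
  have "a - a' + b - b' + c - c' = 0"
    using x mem l by (intro dvd_bounded_imp_eq_0[OF dvd]) (elim insertE emptyE; simp add: sets)
  then show False
    using x mem by (elim insertE emptyE) (simp_all add: sets)
qed

text \<open>Both properties are tested coordinate by coordinate: the triple product property holds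
  in every coordinate, and three words that are not all equal have a coordinate in which the sum
  cannot vanish.\<close>

lemma local_USP_imp_STPP:
  assumes l: "3 \<le> l" and U: "local_USP k U"
  shows "simultaneous_triple_product_property (Cyc_power l k) U (A_prod l k) (B_prod l k) (C_prod l k)"
  unfolding Cyc_power_eq
proof -
  let ?G = "Cyc_product l {1..k}"
  have G: "carrier ?G = {1..k} \<rightarrow>\<^sub>E {0..<int l}"
    using l by (intro carrier_Cyc_product) simp
  have symbols: "u i \<in> {1, 2, 3}" if "u \<in> U" "i \<in> {1..k}" for u i
    using U that unfolding local_USP_def by blast
  have sub: "A_prod l k u \<subseteq> carrier ?G" "B_prod l k u \<subseteq> carrier ?G" "C_prod l k u \<subseteq> carrier ?G"
    if "u \<in> U" for u
    unfolding G A_prod_def B_prod_def C_prod_def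
    by (rule PiE_mono, rule symbol_sets_subset[OF l symbols[OF that]], assumption)+
  have "triple_product_property ?G (A_prod l k u) (B_prod l k u) (C_prod l k u)" if u: "u \<in> U" for u
    unfolding triple_product_property_def
  proof (intro conjI ballI impI sub[OF u])
    fix q1 q2 q3
    assume "q1 \<in> quotient_set ?G (A_prod l k u)" "q2 \<in> quotient_set ?G (B_prod l k u)"
      "q3 \<in> quotient_set ?G (C_prod l k u)" and one: "q1 \<otimes>\<^bsub>?G\<^esub> q2 \<otimes>\<^bsub>?G\<^esub> q3 = \<one>\<^bsub>?G\<^esub>"
    then obtain a a' b b' c c' where
      mem: "a \<in> A_prod l k u" "a' \<in> A_prod l k u" "b \<in> B_prod l k u" "b' \<in> B_prod l k u"
        "c \<in> C_prod l k u" "c' \<in> C_prod l k u" and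
      q: "q1 = a \<otimes>\<^bsub>?G\<^esub> inv\<^bsub>?G\<^esub> a'" "q2 = b \<otimes>\<^bsub>?G\<^esub> inv\<^bsub>?G\<^esub> b'" "q3 = c \<otimes>\<^bsub>?G\<^esub> inv\<^bsub>?G\<^esub> c'"
      unfolding quotient_set_def by blast
    have carr: "a \<in> carrier ?G" "a' \<in> carrier ?G" "b \<in> carrier ?G" "b' \<in> carrier ?G"
      "c \<in> carrier ?G" "c' \<in> carrier ?G"
      using mem sub[OF u] by blast+
    have dvd: "\<forall>i\<in>{1..k}. int l dvd a i - a' i + b i - b' i + c i - c' i"
      using one Cyc_product_quotients_eq_one[OF carr(2,4,6)] unfolding q by blast
    have eq: "a i = a' i \<and> b i = b' i \<and> c i = c' i" if i: "i \<in> {1..k}" for i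
      by (rule symbol_sets_TPP[OF l symbols[OF u i] A_prod_mem[OF mem(1) i] A_prod_mem[OF mem(2) i]
            B_prod_mem[OF mem(3) i] B_prod_mem[OF mem(4) i] C_prod_mem[OF mem(5) i]
            C_prod_mem[OF mem(6) i] dvd[THEN bspec, OF i]])
    have "a = a'" "b = b'" "c = c'"
      by (rule PiE_ext[OF carr(1)[unfolded G] carr(2)[unfolded G]], simp add: eq)
        (rule PiE_ext[OF carr(3)[unfolded G] carr(4)[unfolded G]], simp add: eq,
         rule PiE_ext[OF carr(5)[unfolded G] carr(6)[unfolded G]], simp add: eq)
    then show "q1 = \<one>\<^bsub>?G\<^esub>" "q2 = \<one>\<^bsub>?G\<^esub>" "q3 = \<one>\<^bsub>?G\<^esub>"
      using carr Cyc_product_quotient_eq_one unfolding q by blast+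
  qed
  moreover have "u = v \<and> v = w"
    if uvw: "u \<in> U" "v \<in> U" "w \<in> U" and
      mem: "a \<in> A_prod l k u" "a' \<in> A_prod l k v" "b \<in> B_prod l k v" "b' \<in> B_prod l k w"
        "c \<in> C_prod l k w" "c' \<in> C_prod l k u" and
      one: "a \<otimes>\<^bsub>?G\<^esub> inv\<^bsub>?G\<^esub> a' \<otimes>\<^bsub>?G\<^esub> b \<otimes>\<^bsub>?G\<^esub> inv\<^bsub>?G\<^esub> b' \<otimes>\<^bsub>?G\<^esub> c \<otimes>\<^bsub>?G\<^esub> inv\<^bsub>?G\<^esub> c' = \<one>\<^bsub>?G\<^esub>"
    for u v w a a' b b' c c'
  proof (rule ccontr)
    assume "\<not> (u = v \<and> v = w)"
    then obtain i where i: "i \<in> {1..k}" and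
      pat: "(u i, v i, w i) \<in> {(1,2,1), (1,2,2), (1,1,3), (1,3,3), (2,2,3), (3,2,3), (1,2,3)}"
      using U uvw unfolding local_USP_def by blast
    have "a' \<in> carrier ?G" "b' \<in> carrier ?G" "c' \<in> carrier ?G"
      using mem sub uvw by blast+
    from Cyc_product_word_eq_one[OF this] one i have "int l dvd a i - a' i + b i - b' i + c i - c' i"
      by blast
    moreover have "\<not> int l dvd a i - a' i + b i - b' i + c i - c' i"
      by (rule symbol_sets_USP[OF l pat A_prod_mem[OF mem(1) i] A_prod_mem[OF mem(2) i]
            B_prod_mem[OF mem(3) i] B_prod_mem[OF mem(4) i] C_prod_mem[OF mem(5) i]
            C_prod_mem[OF mem(6) i]])
    ultimately show False by contradiction
  qed
  ultimately show "simultaneous_triple_product_property ?G U (A_prod l k) (B_prod l k) (C_prod l k)"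
    unfolding simultaneous_triple_product_property_def by (intro conjI ballI impI) simp_all
qed

section \<open>Words using every symbol equally often\<close>

definition balanced_words :: "nat \<Rightarrow> (nat \<Rightarrow> nat) set" where
  "balanced_words n = {u \<in> {1..3 * n} \<rightarrow>\<^sub>E {1, 2, 3}.
     \<forall>s\<in>{1, 2, 3}. card {i \<in> {1..3 * n}. u i = s} = n}"

text \<open>Each set has \<open>l - 2\<close> elements at exactly one symbol, namely 3 for A, 1 for
  B and 2 for C, and is a singleton at the others. Equal frequencies thus give equal sizes.\<close>

lemma card_balanced_prods:
  assumes "3 \<le> l" "u \<in> balanced_words n"
  shows "card (A_prod l (3 * n) u) = (l - 2) ^ n" "card (B_prod l (3 * n) u) = (l - 2) ^ n"
    "card (C_prod l (3 * n) u) = (l - 2) ^ n"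
proof -
  have "0 < l" using assms(1) by simp
  note sets = A_set_simps[OF this] B_set_simps[OF this] C_set_simps[OF this]
  have u: "u i \<in> {1, 2, 3}" if "i \<in> {1..3 * n}" for i
    using assms(2) that unfolding balanced_words_def by blast
  have count: "card {i \<in> {1..3 * n}. u i = s} = n" if "s \<in> {1, 2, 3}" for s
    using assms(2) that unfolding balanced_words_def by blast
  have prod: "card (\<Pi>\<^sub>E i\<in>{1..3 * n}. S (u i)) = (l - 2) ^ n"
    if "s \<in> {1, 2, 3}" and S: "\<And>t. t \<in> {1, 2, 3} \<Longrightarrow> card (S t) = (if t = s then l - 2 else 1)"
    for s and S :: "nat \<Rightarrow> int set"
  proof -
    have "card (\<Pi>\<^sub>E i\<in>{1..3 * n}. S (u i)) = (\<Prod>i\<in>{1..3 * n}. if u i = s then l - 2 else 1)"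
      unfolding card_PiE[OF finite_atLeastAtMost] by (intro prod.cong refl S u)
    also have "\<dots> = (\<Prod>i\<in>{i \<in> {1..3 * n}. u i = s}. l - 2)"
      by (rule prod.inter_filter[symmetric]) simp
    finally show ?thesis using count[OF that(1)] by simp
  qed
  show "card (A_prod l (3 * n) u) = (l - 2) ^ n"
    unfolding A_prod_def by (rule prod[of 3]) (auto simp: sets)
  show "card (B_prod l (3 * n) u) = (l - 2) ^ n"
    unfolding B_prod_def by (rule prod[of 1]) (use assms(1) in \<open>auto simp: sets\<close>)
  show "card (C_prod l (3 * n) u) = (l - 2) ^ n"
    unfolding C_prod_def by (rule prod[of 2]) (auto simp: sets)
qed

section \<open>Hash equations and balanced words\<close>

text \<open>Changing the weight at the pivot \<open>p\<close> does not affect \<open>P\<close>, and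
  exactly one value of it solves the new equation. The pivot has coefficient 1, so this works for
  every modulus, in particular for the powers used later.\<close>

lemma card_hash_equation:
  fixes M b :: int and V F :: "'i set" and P :: "('i \<Rightarrow> int) \<Rightarrow> bool"
  assumes fin: "finite V" and p: "p \<in> F" and F: "F \<subseteq> V" and b: "b \<in> {0..<M}"
    and P: "\<And>w c. P (w(p := c)) = P w"
  shows "card {w \<in> V \<rightarrow>\<^sub>E {0..<M}. P w \<and> (\<Sum>i\<in>F. w i) mod M = b} * nat M =
    card {w \<in> V \<rightarrow>\<^sub>E {0..<M}. P w}"
proof -
  let ?E = "{w \<in> V \<rightarrow>\<^sub>E {0..<M}. P w \<and> (\<Sum>i\<in>F. w i) mod M = b}"
  let ?A = "{w \<in> V \<rightarrow>\<^sub>E {0..<M}. P w}"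
  define rest where "rest = (\<lambda>w :: 'i \<Rightarrow> int. \<Sum>i\<in>F - {p}. w i)"
  have M: "0 < M" using b by auto
  have finF: "finite F" using F fin by (rule finite_subset)
  have sum: "(\<Sum>i\<in>F. w i) = w p + rest w" for w :: "'i \<Rightarrow> int"
    unfolding rest_def using sum.remove[OF finF p] .
  have rest_upd: "rest (w(p := c)) = rest w" for w and c :: int
    unfolding rest_def by (intro sum.cong refl) auto
  have upd: "w(p := c) \<in> V \<rightarrow>\<^sub>E {0..<M}" if "w \<in> V \<rightarrow>\<^sub>E {0..<M}" "c \<in> {0..<M}" for w c
    using PiE_fun_upd[of c "\<lambda>_. {0..<M}" p w V] that p F by (simp add: insert_absorb subsetD)
  have range: "w p \<in> {0..<M}" if "w \<in> V \<rightarrow>\<^sub>E {0..<M}" for w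
    using that p F by (metis PiE_mem subsetD)
  have inverse: "w p = (b - rest w) mod M" if "w \<in> ?E" for w
  proof -
    have "(b - rest w) mod M = ((w p + rest w) mod M - rest w) mod M"
      using that by (simp add: sum)
    also have "\<dots> = w p mod M" by (simp add: mod_simps)
    also have "\<dots> = w p" using range that by simp
    finally show ?thesis ..
  qed
  have solve: "(b - rest w) mod M \<in> {0..<M}" "((b - rest w) mod M + rest w) mod M = b" for w
    using M b by (simp_all add: mod_simps)
  have "bij_betw (\<lambda>(w, c). w(p := c)) (?E \<times> {0..<M}) ?A"
  proof (rule bij_betw_byWitness[where f' = "\<lambda>w. (w(p := (b - rest w) mod M), w p)"])
    show "\<forall>x\<in>?E \<times> {0..<M}. (\<lambda>w. (w(p := (b - rest w) mod M), w p)) ((\<lambda>(w, c). w(p := c)) x) = x"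
    proof (rule ballI)
      fix x assume "x \<in> ?E \<times> {0..<M}"
      then obtain w c where x: "x = (w, c)" and w: "w \<in> ?E" by (cases x) simp
      from inverse[OF w] have "w(p := (b - rest w) mod M) = w" by (metis fun_upd_triv)
      then show "(\<lambda>w. (w(p := (b - rest w) mod M), w p)) ((\<lambda>(w, c). w(p := c)) x) = x"
        unfolding x by (simp add: rest_upd)
    qed
    show "\<forall>w\<in>?A. (\<lambda>(w, c). w(p := c)) (w(p := (b - rest w) mod M), w p) = w"
      by simp
    show "(\<lambda>(w, c). w(p := c)) ` (?E \<times> {0..<M}) \<subseteq> ?A"
    proof (rule image_subsetI)
      fix x assume "x \<in> ?E \<times> {0..<M}"
      then obtain w c where x: "x = (w, c)" and w: "w \<in> ?E" and c: "c \<in> {0..<M}" by (cases x) simp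
      have "w(p := c) \<in> V \<rightarrow>\<^sub>E {0..<M}" using w c by (intro upd) simp_all
      then show "(\<lambda>(w, c). w(p := c)) x \<in> ?A" using w P x by simp
    qed
    show "(\<lambda>w. (w(p := (b - rest w) mod M), w p)) ` ?A \<subseteq> ?E \<times> {0..<M}"
    proof (rule image_subsetI)
      fix w assume w: "w \<in> ?A"
      then have "w(p := (b - rest w) mod M) \<in> V \<rightarrow>\<^sub>E {0..<M}" using upd solve(1) by blast
      moreover have "(\<Sum>i\<in>F. (w(p := (b - rest w) mod M)) i) mod M = b"
        unfolding sum rest_upd using solve(2) by simp
      ultimately show "(w(p := (b - rest w) mod M), w p) \<in> ?E \<times> {0..<M}"
        using w P range by simp
    qed
  qed
  from bij_betw_same_card[OF this] show ?thesis
    by (simp add: card_cartesian_product)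
qed

text \<open>The equations form a triangular system: \<open>F2\<close> has a pivot outside
  \<open>F1\<close>.\<close>

lemma card_hash_equations2:
  fixes M :: int and V F1 F2 :: "'i set"
  assumes "finite V" "F1 \<subseteq> V" "F2 \<subseteq> V" "F1 \<noteq> {}" "\<not> F2 \<subseteq> F1" "b \<in> {0..<M}"
  shows "card {w \<in> V \<rightarrow>\<^sub>E {0..<M}. (\<Sum>i\<in>F1. w i) mod M = b \<and> (\<Sum>i\<in>F2. w i) mod M = b} * nat M ^ 2 =
    nat M ^ card V"
proof -
  obtain p1 p2 where p: "p1 \<in> F1" "p2 \<in> F2" "p2 \<notin> F1" using assms by blast
  have "card {w \<in> V \<rightarrow>\<^sub>E {0..<M}. (\<Sum>i\<in>F1. w i) mod M = b \<and> (\<Sum>i\<in>F2. w i) mod M = b} * nat M =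
      card {w \<in> V \<rightarrow>\<^sub>E {0..<M}. (\<Sum>i\<in>F1. w i) mod M = b}"
    using p by (intro card_hash_equation[OF assms(1) p(2) assms(3,6)] arg_cong2[where f = "\<lambda>x y. x mod M = y"]
        sum.cong refl) auto
  moreover have "card {w \<in> V \<rightarrow>\<^sub>E {0..<M}. True \<and> (\<Sum>i\<in>F1. w i) mod M = b} * nat M =
      card {w \<in> V \<rightarrow>\<^sub>E {0..<M}. True}"
    by (rule card_hash_equation[OF assms(1) p(1) assms(2,6)]) simp
  moreover have "card {w \<in> V \<rightarrow>\<^sub>E {0..<M}. True} = nat M ^ card V"
    using assms(1) by (simp add: card_PiE)
  ultimately show ?thesis by (simp add: power2_eq_square flip: mult.assoc)
qed

lemma card_hash_equations3:
  fixes M :: int and V F1 F2 :: "'i set"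
  assumes "finite V" "F1 \<subseteq> V" "F2 \<subseteq> V" "F3 \<subseteq> V" "F1 \<noteq> {}" "\<not> F2 \<subseteq> F1" "\<not> F3 \<subseteq> F1 \<union> F2"
    "b \<in> {0..<M}"
  shows "card {w \<in> V \<rightarrow>\<^sub>E {0..<M}. ((\<Sum>i\<in>F1. w i) mod M = b \<and> (\<Sum>i\<in>F2. w i) mod M = b) \<and>
    (\<Sum>i\<in>F3. w i) mod M = b} * nat M ^ 3 = nat M ^ card V"
proof -
  obtain p where p: "p \<in> F3" "p \<notin> F1" "p \<notin> F2" using assms by blast
  have "(\<Sum>i\<in>F. (w(p := c)) i) = (\<Sum>i\<in>F. w i)" if "p \<notin> F" for F and w :: "'i \<Rightarrow> int" and c
    using that by (intro sum.cong refl) auto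
  then have "card {w \<in> V \<rightarrow>\<^sub>E {0..<M}. ((\<Sum>i\<in>F1. w i) mod M = b \<and> (\<Sum>i\<in>F2. w i) mod M = b) \<and>
      (\<Sum>i\<in>F3. w i) mod M = b} * nat M =
    card {w \<in> V \<rightarrow>\<^sub>E {0..<M}. (\<Sum>i\<in>F1. w i) mod M = b \<and> (\<Sum>i\<in>F2. w i) mod M = b}"
    using p by (intro card_hash_equation[OF assms(1) p(1) assms(4,8)]) simp
  then show ?thesis
    using card_hash_equations2[OF assms(1-3,5,6,8)]
    by (simp only: power3_eq_cube power2_eq_square mult.assoc[symmetric])
qed

section \<open>The three blocks of a balanced word\<close>

definition positions :: "nat \<Rightarrow> (nat \<Rightarrow> nat) \<Rightarrow> nat \<Rightarrow> nat set" where
  "positions n u s = {i \<in> {1..3 * n}. u i = s}"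

lemma positions_subset: "positions n u s \<subseteq> {1..3 * n}"
  unfolding positions_def by blast

lemma finite_positions [simp]: "finite (positions n u s)"
  unfolding positions_def by simp

lemma zero_notin_positions [simp]: "0 \<notin> positions n u s"
  unfolding positions_def by simp

lemma positions_disjoint: "s \<noteq> t \<Longrightarrow> positions n u s \<inter> positions n u t = {}"
  unfolding positions_def by blast

lemma positions_Un:
  assumes "u \<in> balanced_words n"
  shows "positions n u 1 \<union> positions n u 2 \<union> positions n u 3 = {1..3 * n}"
  using assms unfolding positions_def balanced_words_def by blast

lemma card_positions:
  "u \<in> balanced_words n \<Longrightarrow> s \<in> {1, 2, 3} \<Longrightarrow> card (positions n u s) = n"
  unfolding balanced_words_def positions_def by blast

lemma finite_balanced_words [simp]: "finite (balanced_words n)"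
proof (rule finite_subset)
  show "balanced_words n \<subseteq> {1..3 * n} \<rightarrow>\<^sub>E {1, 2, 3}" unfolding balanced_words_def by blast
qed (simp add: finite_PiE)

lemma balanced_words_eqI:
  assumes "u \<in> balanced_words n" "v \<in> balanced_words n" "s \<in> {1, 2, 3}" "t \<in> {1, 2, 3}" "s \<noteq> t"
    and "positions n u s = positions n v s" "positions n u t = positions n v t"
  shows "u = v"
proof (rule PiE_ext)
  show "u \<in> {1..3 * n} \<rightarrow>\<^sub>E {1, 2, 3}" "v \<in> {1..3 * n} \<rightarrow>\<^sub>E {1, 2, 3}"
    using assms(1,2) unfolding balanced_words_def by blast+
  fix i assume i: "i \<in> {1..3 * n}"
  have "u i \<in> {1, 2, 3}" "v i \<in> {1, 2, 3}"
    using assms(1,2) i unfolding balanced_words_def by blast+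
  moreover have "u i = s \<longleftrightarrow> v i = s" "u i = t \<longleftrightarrow> v i = t"
    using assms(6,7) i unfolding positions_def by blast+
  ultimately show "u i = v i" using assms(3-5) by auto
qed

definition word_of :: "nat \<Rightarrow> nat set \<Rightarrow> nat set \<Rightarrow> nat \<Rightarrow> nat" where
  "word_of n X Y = (\<lambda>i\<in>{1..3 * n}. if i \<in> X then 1 else if i \<in> Y then 2 else 3)"

lemma positions_word_of:
  assumes "X \<subseteq> {1..3 * n}" "Y \<subseteq> {1..3 * n} - X"
  shows "positions n (word_of n X Y) 1 = X" "positions n (word_of n X Y) 2 = Y"
    "positions n (word_of n X Y) 3 = {1..3 * n} - X - Y"
  using assms unfolding positions_def word_of_def by auto

lemma word_of_balanced:
  assumes "X \<subseteq> {1..3 * n}" "card X = n" "Y \<subseteq> {1..3 * n} - X" "card Y = n"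
  shows "word_of n X Y \<in> balanced_words n"
proof -
  have fin: "finite X" "finite Y" using assms(1,3) finite_subset by blast+
  have "card ({1..3 * n} - X - Y) = n"
    using assms fin by (simp add: card_Diff_subset)
  then have "card (positions n (word_of n X Y) s) = n" if "s \<in> {1, 2, 3}" for s
    using that assms positions_word_of[OF assms(1,3)] by auto
  moreover have "word_of n X Y \<in> {1..3 * n} \<rightarrow>\<^sub>E {1, 2, 3}"
    unfolding word_of_def by auto
  ultimately show ?thesis
    unfolding balanced_words_def positions_def by blast
qed

lemma card_balanced_words_ge:
  "(3 * n choose n) * (2 * n choose n) \<le> card (balanced_words n)"
proof -
  let ?X = "{X. X \<subseteq> {1..3 * n} \<and> card X = n}" and ?Y = "\<lambda>X. {Y. Y \<subseteq> {1..3 * n} - X \<and> card Y = n}"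
  have "card (?Y X) = 2 * n choose n" if "X \<in> ?X" for X
  proof -
    have "finite X" using that finite_subset by blast
    then have "card ({1..3 * n} - X) = 2 * n" using that by (simp add: card_Diff_subset)
    then show ?thesis using n_subsets[of "{1..3 * n} - X" n] by simp
  qed
  then have "card (Sigma ?X ?Y) = (3 * n choose n) * (2 * n choose n)"
    using n_subsets[of "{1..3 * n}" n] by (subst card_SigmaI) simp_all
  moreover have "inj_on (\<lambda>(X, Y). word_of n X Y) (Sigma ?X ?Y)"
  proof (rule inj_onI)
    fix x x' assume *: "x \<in> Sigma ?X ?Y" "x' \<in> Sigma ?X ?Y"
      "(\<lambda>(X, Y). word_of n X Y) x = (\<lambda>(X, Y). word_of n X Y) x'"
    obtain X Y X' Y' where x: "x = (X, Y)" "x' = (X', Y')" by fastforce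
    with * have "X \<subseteq> {1..3 * n}" "Y \<subseteq> {1..3 * n} - X" "X' \<subseteq> {1..3 * n}" "Y' \<subseteq> {1..3 * n} - X'"
      "word_of n X Y = word_of n X' Y'"
      by simp_all
    then show "x = x'" using positions_word_of x by metis
  qed
  moreover have "(\<lambda>(X, Y). word_of n X Y) ` Sigma ?X ?Y \<subseteq> balanced_words n"
    using word_of_balanced by auto
  ultimately show ?thesis
    using card_inj_on_le[of "\<lambda>(X, Y). word_of n X Y" "Sigma ?X ?Y" "balanced_words n"] by simp
qed

text \<open>Two blocks determine a balanced word, and the second one is an \<open>n\<close>-subset
  of the remaining \<open>2 * n\<close> positions.\<close>

lemma card_same_positions_le:
  assumes "u \<in> balanced_words n" "s \<in> {1, 2, 3}"
  shows "card {v \<in> balanced_words n. positions n v s = positions n u s} \<le> 2 * n choose n"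
proof -
  let ?A = "{v \<in> balanced_words n. positions n v s = positions n u s}"
  let ?R = "{1..3 * n} - positions n u s"
  obtain t :: nat where t: "t \<in> {1, 2, 3}" "s \<noteq> t" 
    by (rule that[of "if s = 1 then 2 else 1"]) simp_all
  have "inj_on (\<lambda>v. positions n v t) ?A"
  proof (rule inj_onI)
    fix v v' assume "v \<in> ?A" "v' \<in> ?A" "positions n v t = positions n v' t"
    then show "v = v'"
      by (intro balanced_words_eqI[OF _ _ assms(2) t]) simp_all
  qed
  moreover have "(\<lambda>v. positions n v t) ` ?A \<subseteq> {Y. Y \<subseteq> ?R \<and> card Y = n}"
  proof (rule image_subsetI)
    fix v assume v: "v \<in> ?A"
    have "positions n v t \<inter> positions n v s = {}"
      by (rule positions_disjoint) (use t(2) in simp)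
    then show "positions n v t \<in> {Y. Y \<subseteq> ?R \<and> card Y = n}"
      using v positions_subset[of n v t] card_positions[OF _ t(1)] by auto
  qed
  ultimately have "card ?A \<le> card {Y. Y \<subseteq> ?R \<and> card Y = n}"
    by (intro card_inj_on_le) simp_all
  also have "\<dots> = card ?R choose n"
    by (rule n_subsets) simp
  also have "card ?R = 2 * n"
    using card_Diff_subset[OF finite_positions positions_subset] card_positions[OF assms] by simp
  finally show ?thesis .
qed

section \<open>Hashing\<close>

definition AP_free_mod :: "int \<Rightarrow> int set \<Rightarrow> bool" where
  "AP_free_mod M B \<longleftrightarrow> B \<subseteq> {0..<M} \<and>
     (\<forall>x\<in>B. \<forall>y\<in>B. \<forall>z\<in>B. (x + y) mod M = (2 * z) mod M \<longrightarrow> x = z \<and> y = z)"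

definition hash :: "int \<Rightarrow> (nat \<Rightarrow> int) \<Rightarrow> nat set \<Rightarrow> int" where
  "hash M w F = (\<Sum>i\<in>F. w i) mod M"

text \<open>
  Coppersmith and Winograd also hash the third block, with the mean of the two values below. Here
  this is implied, and the sum of the two values is determined by the third block alone.
\<close>

definition hashed_words :: "nat \<Rightarrow> int \<Rightarrow> int set \<Rightarrow> (nat \<Rightarrow> int) \<Rightarrow> (nat \<Rightarrow> nat) set" where
  "hashed_words n M B w = {u \<in> balanced_words n. \<exists>b\<in>B.
     hash M w (positions n u 1) = b \<and> hash M w (insert 0 (positions n u 2)) = b}"

definition conflicts :: "nat \<Rightarrow> ((nat \<Rightarrow> nat) \<times> (nat \<Rightarrow> nat)) set" where
  "conflicts n = {(u, v). u \<in> balanced_words n \<and> v \<in> balanced_words n \<and> u \<noteq> v \<and>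
     (\<exists>s\<in>{1, 2, 3}. positions n v s = positions n u s)}"

text \<open>Conflicts are tested against all hashed words, not only against isolated ones, because
  the word assembled in \<open>isolated_words_local_USP\<close> is at first only known to be
  hashed.\<close>

definition isolated_words :: "nat \<Rightarrow> int \<Rightarrow> int set \<Rightarrow> (nat \<Rightarrow> int) \<Rightarrow> (nat \<Rightarrow> nat) set" where
  "isolated_words n M B w =
     {u \<in> hashed_words n M B w. \<forall>v\<in>hashed_words n M B w. (u, v) \<notin> conflicts n}"

lemma isolated_words_eqI:
  assumes "u \<in> isolated_words n M B w" "v \<in> hashed_words n M B w" "s \<in> {1, 2, 3}"
    "positions n v s = positions n u s"
  shows "v = u"
  using assms unfolding isolated_words_def conflicts_def hashed_words_def by blast

lemma hash_Un:
  assumes "finite F" "finite F'" "F \<inter> F' = {}"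
  shows "hash M w (F \<union> F') = (hash M w F + hash M w F') mod M"
  using assms unfolding hash_def by (simp add: sum.union_disjoint mod_simps)

lemma hash_without_third:
  assumes "u \<in> balanced_words n"
  shows "hash M w ({0..3 * n} - positions n u 3) =
    (hash M w (positions n u 1) + hash M w (insert 0 (positions n u 2))) mod M"
proof -
  have "{0..3 * n} = insert 0 {1..3 * n}" by auto
  then have eq: "{0..3 * n} - positions n u 3 = positions n u 1 \<union> insert 0 (positions n u 2)"
    using positions_Un[OF assms] positions_disjoint[of 3 1 n u] positions_disjoint[of 3 2 n u]
      zero_notin_positions[of n u 3] by auto
  show ?thesis
    unfolding eq
  proof (rule hash_Un)
    show "positions n u 1 \<inter> insert 0 (positions n u 2) = {}"
      using positions_disjoint[of 1 2 n u] zero_notin_positions[of n u 1] by simp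
  qed simp_all
qed

text \<open>The seven patterns are exactly the triples for which at least two of
  \<open>u i = 1\<close>, \<open>v i = 2\<close>, \<open>x i = 3\<close> hold. If none occurs, these
  three blocks are disjoint and, having \<open>n\<close> elements each, partition the coordinates
  into the blocks of a new word. That word turns out to be hashed, and isolation identifies it with
  all three given words.\<close>

lemma isolated_words_local_USP:
  assumes "AP_free_mod M B"
  shows "local_USP (3 * n) (isolated_words n M B w)"
  unfolding local_USP_def
proof (intro conjI ballI impI)
  let ?K = "{1..3 * n}"
  have bal: "u \<in> balanced_words n" if "u \<in> isolated_words n M B w" for u
    using that unfolding isolated_words_def hashed_words_def by blast
  then show "isolated_words n M B w \<subseteq> ?K \<rightarrow>\<^sub>E {1, 2, 3}"
    unfolding balanced_words_def by blast
  fix u v x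
  assume uvx: "u \<in> isolated_words n M B w" "v \<in> isolated_words n M B w" "x \<in> isolated_words n M B w"
    and neq: "\<not> (u = v \<and> v = x)"
  show "\<exists>i\<in>?K. (u i, v i, x i) \<in> {(1,2,1), (1,2,2), (1,1,3), (1,3,3), (2,2,3), (3,2,3), (1,2,3)}"
  proof (rule ccontr)
    assume none: "\<not> (\<exists>i\<in>?K. (u i, v i, x i) \<in> {(1,2,1), (1,2,2), (1,1,3), (1,3,3), (2,2,3), (3,2,3), (1,2,3)})"
    let ?X = "positions n u 1" and ?Y = "positions n v 2" and ?Z = "positions n x 3"
    have "i \<notin> ?X \<inter> ?Y \<union> ?X \<inter> ?Z \<union> ?Y \<inter> ?Z" for i
    proof
      assume i: "i \<in> ?X \<inter> ?Y \<union> ?X \<inter> ?Z \<union> ?Y \<inter> ?Z"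
      then have "i \<in> ?K" using positions_subset by blast
      moreover have "u i \<in> {1, 2, 3}" "v i \<in> {1, 2, 3}" "x i \<in> {1, 2, 3}"
        using bal[OF uvx(1)] bal[OF uvx(2)] bal[OF uvx(3)] \<open>i \<in> ?K\<close> unfolding balanced_words_def by blast+
      moreover have "u i = 1 \<and> v i = 2 \<or> u i = 1 \<and> x i = 3 \<or> v i = 2 \<and> x i = 3"
        using i unfolding positions_def by blast
      ultimately have "(u i, v i, x i) \<in> {(1,2,1), (1,2,2), (1,1,3), (1,3,3), (2,2,3), (3,2,3), (1,2,3)}"
        by (elim insertE emptyE disjE conjE) simp_all
      then show False using none \<open>i \<in> ?K\<close> by blast
    qed
    then have disj: "?X \<inter> ?Y = {}" "?X \<inter> ?Z = {}" "?Y \<inter> ?Z = {}" by blast+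
    have cards: "card ?X = n" "card ?Y = n" "card ?Z = n"
      using bal uvx by (simp_all add: card_positions)
    have "?X \<union> ?Y \<union> ?Z = ?K"
    proof (rule card_subset_eq)
      show "?X \<union> ?Y \<union> ?Z \<subseteq> ?K" using positions_subset by simp
      have "card (?X \<union> ?Y \<union> ?Z) = n + n + n"
        using disj cards by (simp add: card_Un_disjoint Int_Un_distrib2)
      then show "card (?X \<union> ?Y \<union> ?Z) = card ?K" by simp
    qed simp
    then have Z: "?Z = ?K - ?X - ?Y" using disj by blast
    have XY: "?X \<subseteq> ?K" "?Y \<subseteq> ?K - ?X" using disj positions_subset[of n u 1] positions_subset[of n v 2] by blast+
    \<comment> \<open>The word whose blocks are the first of \<open>u\<close>, the second of
      \<open>v\<close> and the third of \<open>x\<close>.\<close>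
    define t where "t = word_of n ?X ?Y"
    have t: "t \<in> balanced_words n"
      unfolding t_def using XY cards by (intro word_of_balanced)
    have t1: "positions n t 1 = ?X" and t2: "positions n t 2 = ?Y" and t3: "positions n t 3 = ?Z"
      unfolding t_def using positions_word_of[OF XY] Z by simp_all
    obtain b1 where b1: "b1 \<in> B" "hash M w ?X = b1"
      using uvx(1) unfolding isolated_words_def hashed_words_def by blast
    obtain b2 where b2: "b2 \<in> B" "hash M w (insert 0 ?Y) = b2"
      using uvx(2) unfolding isolated_words_def hashed_words_def by blast
    obtain b3 where b3: "b3 \<in> B" "hash M w (positions n x 1) = b3" "hash M w (insert 0 (positions n x 2)) = b3"
      using uvx(3) unfolding isolated_words_def hashed_words_def by blast
    \<comment> \<open>The third block is common to \<open>t\<close> and \<open>x\<close>, so it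
      determines the sum of the two hash values of either word. This yields a progression b1, b3, b2
      in \<open>B\<close>.\<close>
    have "(b1 + b2) mod M = hash M w ({0..3 * n} - ?Z)"
      using hash_without_third[OF t, of M w] by (simp only: t1 t2 t3 b1 b2)
    also have "\<dots> = (2 * b3) mod M"
      using hash_without_third[OF bal[OF uvx(3)], of M w] by (simp only: b3 mult_2)
    finally have "b1 = b3 \<and> b2 = b3"
      using assms b1(1) b2(1) b3(1) unfolding AP_free_mod_def by blast
    then have "hash M w (positions n t 1) = b3" "hash M w (insert 0 (positions n t 2)) = b3"
      by (simp_all only: t1 t2 b1 b2)
    then have "t \<in> hashed_words n M B w"
      using t b3(1) unfolding hashed_words_def by blast
    then have "t = u" "t = v" "t = x"
      using isolated_words_eqI uvx t1 t2 t3 by blast+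
    then show False using neq by blast
  qed
qed

section \<open>Counting hashed words and conflicts\<close>

text \<open>Double counting: for each word and each \<open>b\<close>, two independent equations hold
  for a fraction M^-2 of the weight vectors. The power \<open>3 * n + 1\<close> includes the weight
  of coordinate 0, and powers of M are multiplied out to stay within the naturals.\<close>

lemma sum_card_hashed_words:
  assumes "0 < n" "B \<subseteq> {0..<M}"
  shows "(\<Sum>w\<in>{0..3 * n} \<rightarrow>\<^sub>E {0..<M}. card (hashed_words n M B w)) * nat M ^ 2 =
    card (balanced_words n) * card B * nat M ^ (3 * n + 1)"
proof -
  let ?V = "{0..3 * n}" and ?W = "{0..3 * n} \<rightarrow>\<^sub>E {0..<M}"
  let ?E = "\<lambda>u b. {w \<in> ?W. hash M w (positions n u 1) = b \<and> hash M w (insert 0 (positions n u 2)) = b}"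
  have finB: "finite B" using assms(2) finite_subset by blast
  have finW: "finite ?W" by (simp add: finite_PiE)
  have "(\<Sum>w\<in>?W. card (hashed_words n M B w)) =
      (\<Sum>u\<in>balanced_words n. card {w \<in> ?W. \<exists>b\<in>B. w \<in> ?E u b})"
    using finW sum_multicount_gen[of ?W "balanced_words n"
      "\<lambda>w u. \<exists>b\<in>B. hash M w (positions n u 1) = b \<and> hash M w (insert 0 (positions n u 2)) = b"
      "\<lambda>u. card {w \<in> ?W. \<exists>b\<in>B. w \<in> ?E u b}"]
    unfolding hashed_words_def by (auto intro!: arg_cong[where f = card])
  moreover have "card {w \<in> ?W. \<exists>b\<in>B. w \<in> ?E u b} * nat M ^ 2 = card B * nat M ^ (3 * n + 1)"
    if u: "u \<in> balanced_words n" for u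
  proof -
    have "{w \<in> ?W. \<exists>b\<in>B. w \<in> ?E u b} = (\<Union>b\<in>B. ?E u b)" by blast
    moreover have "card (\<Union>b\<in>B. ?E u b) = (\<Sum>b\<in>B. card (?E u b))"
      using finB finW by (intro card_UN_disjoint) auto
    moreover have "card (?E u b) * nat M ^ 2 = nat M ^ (3 * n + 1)" if b: "b \<in> B" for b
    proof -
      have "positions n u 1 \<noteq> {}"
        using card_positions[OF u, of 1] assms(1) by auto
      then show ?thesis
        using card_hash_equations2[of ?V "positions n u 1" "insert 0 (positions n u 2)" b M]
          b assms(2) positions_subset[of n u 1] positions_subset[of n u 2]
        by (auto simp: hash_def subset_iff)
    qed
    ultimately show ?thesis by (simp add: sum_distrib_right)
  qed
  ultimately show ?thesis by (simp add: sum_distrib_right)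
qed

lemma card_conflicts_le: "card (conflicts n) \<le> card (balanced_words n) * (3 * (2 * n choose n))"
proof -
  let ?C = "2 * n choose n"
  let ?S = "\<lambda>u s. {v \<in> balanced_words n. positions n v s = positions n u s}"
  have "conflicts n \<subseteq> Sigma (balanced_words n) (\<lambda>u. \<Union>s\<in>{1, 2, 3}. ?S u s)"
    unfolding conflicts_def by blast
  then have "card (conflicts n) \<le> card (Sigma (balanced_words n) (\<lambda>u. \<Union>s\<in>{1, 2, 3}. ?S u s))"
    by (intro card_mono) auto
  also have "\<dots> = (\<Sum>u\<in>balanced_words n. card (\<Union>s\<in>{1, 2, 3}. ?S u s))"
    by (rule card_SigmaI) auto
  also have "\<dots> \<le> (\<Sum>u\<in>balanced_words n. 3 * ?C)"
  proof (rule sum_mono)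
    fix u assume u: "u \<in> balanced_words n"
    have "card (\<Union>s\<in>{1, 2, 3}. ?S u s) \<le> (\<Sum>s\<in>{1, 2, 3}. card (?S u s))"
      by (rule card_UN_le) simp
    also have "\<dots> \<le> (\<Sum>s\<in>{1, 2, 3 :: nat}. ?C)"
      by (rule sum_mono) (rule card_same_positions_le[OF u])
    finally show "card (\<Union>s\<in>{1, 2, 3}. ?S u s) \<le> 3 * ?C" by simp
  qed
  finally show ?thesis by simp
qed

lemma finite_conflicts [simp]: "finite (conflicts n)"
  by (rule finite_subset[of _ "balanced_words n \<times> balanced_words n"])
    (auto simp: conflicts_def)

text \<open>A conflicting pair satisfies three independent equations with a common value, so it
  survives for at most a fraction |B| / M^3 of the weights, against |B| / M^2 for a single word.
  Coordinate 0 is there for pairs sharing the third block: the second block of \<open>u\<close> may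
  then be the first block of \<open>v\<close>, and without the extra weight their equations would
  coincide.\<close>

lemma card_hashed_conflict_le:
  assumes "0 < n" and AP: "AP_free_mod M B" and uv: "(u, v) \<in> conflicts n"
  shows "card {w \<in> {0..3 * n} \<rightarrow>\<^sub>E {0..<M}. u \<in> hashed_words n M B w \<and> v \<in> hashed_words n M B w} *
    nat M ^ 3 \<le> card B * nat M ^ (3 * n + 1)"
proof -
  let ?V = "{0..3 * n}" and ?W = "{0..3 * n} \<rightarrow>\<^sub>E {0..<M}"
  let ?A = "{w \<in> ?W. u \<in> hashed_words n M B w \<and> v \<in> hashed_words n M B w}"
  have B: "B \<subseteq> {0..<M}" using AP unfolding AP_free_mod_def by blast
  have finB: "finite B" using B finite_subset by blast
  have finW: "finite ?W" by (simp add: finite_PiE)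
  have bal: "u \<in> balanced_words n" "v \<in> balanced_words n" and "u \<noteq> v"
    using uv unfolding conflicts_def by blast+
  obtain s where s: "s \<in> {1, 2, 3}" "positions n v s = positions n u s"
    using uv unfolding conflicts_def by blast
  have ne: "positions n u 1 \<noteq> {}"
    using card_positions[OF bal(1), of 1] assms(1) by auto
  have not_sub: "\<not> positions n v t \<subseteq> positions n u t" if "t \<in> {1, 2, 3}" "t \<noteq> s" for t
  proof
    assume "positions n v t \<subseteq> positions n u t"
    then have "positions n v t = positions n u t"
      using card_positions[OF bal(1) that(1)] card_positions[OF bal(2) that(1)]
      by (intro card_subset_eq) simp_all
    then show False
      using balanced_words_eqI[OF bal(2,1) that(1) s(1) that(2)] s(2) \<open>u \<noteq> v\<close> by blast
  qed
  have sub: "positions n y t \<subseteq> ?V" "insert 0 (positions n y t) \<subseteq> ?V" for y t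
    using positions_subset[of n y t] by auto
  have "\<exists>F1 F2 F3. F1 \<subseteq> ?V \<and> F2 \<subseteq> ?V \<and> F3 \<subseteq> ?V \<and> F1 \<noteq> {} \<and> \<not> F2 \<subseteq> F1 \<and> \<not> F3 \<subseteq> F1 \<union> F2 \<and>
    ?A \<subseteq> (\<Union>b\<in>B. {w \<in> ?W. (hash M w F1 = b \<and> hash M w F2 = b) \<and> hash M w F3 = b})"
  proof (cases "s = 1")
    case True
    \<comment> \<open>The pivot is a position in the second block of \<open>v\<close> but not of
      \<open>u\<close>; it avoids the first block, which the two words share.\<close>
    have n3: "\<not> insert 0 (positions n v 2) \<subseteq> positions n u 1 \<union> insert 0 (positions n u 2)"
      using not_sub[of 2] True s(2) positions_disjoint[of 1 2 n v] by auto
    have n2: "\<not> insert 0 (positions n u 2) \<subseteq> positions n u 1"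
      using zero_notin_positions by blast
    have A: "?A \<subseteq> (\<Union>b\<in>B. {w \<in> ?W. (hash M w (positions n u 1) = b \<and>
        hash M w (insert 0 (positions n u 2)) = b) \<and> hash M w (insert 0 (positions n v 2)) = b})"
      using True s(2) unfolding hashed_words_def by auto
    show ?thesis
      by (rule exI[of _ "positions n u 1"], rule exI[of _ "insert 0 (positions n u 2)"],
          rule exI[of _ "insert 0 (positions n v 2)"], intro conjI sub ne n2 n3 A)
  next
    case False
    have A: "?A \<subseteq> (\<Union>b\<in>B. {w \<in> ?W. (hash M w (positions n u 1) = b \<and> hash M w (positions n v 1) = b) \<and>
        hash M w (insert 0 (positions n u 2)) = b})"
    proof
      fix w assume w: "w \<in> ?A"
      then obtain b b' where b: "b \<in> B" "hash M w (positions n u 1) = b" "hash M w (insert 0 (positions n u 2)) = b"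
        and b': "b' \<in> B" "hash M w (positions n v 1) = b'" "hash M w (insert 0 (positions n v 2)) = b'"
        unfolding hashed_words_def by blast
      have "b = b'"
      proof (cases "s = 2")
        case True
        then show ?thesis using b b' s(2) by simp
      next
        case False
        \<comment> \<open>The shared third block gives 2b = 2b' modulo \<open>M\<close>. This is a
          degenerate progression b, b', b, which \<open>AP_free_mod\<close> rules out as well unless
          b = b'.\<close>
        then have "s = 3" using s(1) \<open>s \<noteq> 1\<close> by blast
        then have "(b + b) mod M = (b' + b') mod M"
          using hash_without_third[OF bal(1), of M w] hash_without_third[OF bal(2), of M w] b b' s(2)
          by simp
        then have "(b + b) mod M = (2 * b') mod M" by simp
        then show ?thesis using AP b(1) b'(1) unfolding AP_free_mod_def by blast
      qed
      then show "w \<in> (\<Union>b\<in>B. {w \<in> ?W. (hash M w (positions n u 1) = b \<and> hash M w (positions n v 1) = b) \<and>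
          hash M w (insert 0 (positions n u 2)) = b})"
        using w b b' by blast
    qed
    \<comment> \<open>Here the pivot is coordinate 0, which lies in no block.\<close>
    have n3: "\<not> insert 0 (positions n u 2) \<subseteq> positions n u 1 \<union> positions n v 1"
      using zero_notin_positions by blast
    have n2: "\<not> positions n v 1 \<subseteq> positions n u 1"
      by (rule not_sub) (use False in simp_all)
    show ?thesis
      by (rule exI[of _ "positions n u 1"], rule exI[of _ "positions n v 1"],
          rule exI[of _ "insert 0 (positions n u 2)"], intro conjI sub ne n2 n3 A)
  qed
  then obtain F1 F2 F3 where F: "F1 \<subseteq> ?V" "F2 \<subseteq> ?V" "F3 \<subseteq> ?V" "F1 \<noteq> {}" "\<not> F2 \<subseteq> F1" "\<not> F3 \<subseteq> F1 \<union> F2"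
    and A: "?A \<subseteq> (\<Union>b\<in>B. {w \<in> ?W. (hash M w F1 = b \<and> hash M w F2 = b) \<and> hash M w F3 = b})"
    by (elim exE conjE)
  let ?E = "\<lambda>b. {w \<in> ?W. (hash M w F1 = b \<and> hash M w F2 = b) \<and> hash M w F3 = b}"
  have "card ?A \<le> card (\<Union>b\<in>B. ?E b)"
    using finB finW by (intro card_mono[OF _ A]) simp
  also have "\<dots> \<le> (\<Sum>b\<in>B. card (?E b))"
    using finB by (rule card_UN_le)
  finally have "card ?A * nat M ^ 3 \<le> (\<Sum>b\<in>B. card (?E b)) * nat M ^ 3"
    by (rule mult_right_mono) simp
  also have "\<dots> = (\<Sum>b\<in>B. card (?E b) * nat M ^ 3)"
    by (rule sum_distrib_right)
  also have "\<dots> = (\<Sum>b\<in>B. nat M ^ (3 * n + 1))"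
    using card_hash_equations3[OF finite_atLeastAtMost F] B
    by (intro sum.cong refl) (auto simp: hash_def)
  finally show ?thesis by simp
qed

lemma card_isolated_words_ge:
  "card (hashed_words n M B w) \<le> card (isolated_words n M B w) +
    card {(u, v) \<in> conflicts n. u \<in> hashed_words n M B w \<and> v \<in> hashed_words n M B w}"
proof -
  let ?P = "{(u, v) \<in> conflicts n. u \<in> hashed_words n M B w \<and> v \<in> hashed_words n M B w}"
  have fin: "finite ?P" by (rule finite_subset[OF _ finite_conflicts]) auto
  have "finite (isolated_words n M B w)"
    by (rule finite_subset[OF _ finite_balanced_words]) (auto simp: isolated_words_def hashed_words_def)
  moreover have "hashed_words n M B w \<subseteq> isolated_words n M B w \<union> fst ` ?P"
    unfolding isolated_words_def by force
  ultimately have "card (hashed_words n M B w) \<le> card (isolated_words n M B w \<union> fst ` ?P)"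
    using fin by (intro card_mono) simp_all
  also have "\<dots> \<le> card (isolated_words n M B w) + card (fst ` ?P)" by (rule card_Un_le)
  also have "\<dots> \<le> card (isolated_words n M B w) + card ?P"
    using card_image_le[OF fin] by simp
  finally show ?thesis .
qed

text \<open>The deletion method: delete every hashed word that takes part in a conflict. By
  averaging, some weight vector leaves at least the mean number of isolated words.\<close>

lemma exists_large_local_USP:
  assumes "0 < n" and AP: "AP_free_mod M B" and M: "6 * (2 * n choose n) \<le> nat M"
  shows "\<exists>U. local_USP (3 * n) U \<and> U \<subseteq> balanced_words n \<and>
    card (balanced_words n) * card B \<le> 2 * nat M ^ 2 * card U"
proof -
  let ?W = "{0..3 * n} \<rightarrow>\<^sub>E {0..<M}" and ?T = "card (balanced_words n)" and ?m = "nat M"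
  let ?C = "2 * n choose n" and ?N = "nat M ^ (3 * n + 1)"
  let ?conf = "\<lambda>w. {(u, v) \<in> conflicts n. u \<in> hashed_words n M B w \<and> v \<in> hashed_words n M B w}"
  have finW: "finite ?W" by (simp add: finite_PiE)
  have cardW: "card ?W = ?N" by (simp add: card_PiE)
  have B: "B \<subseteq> {0..<M}" using AP unfolding AP_free_mod_def by blast
  have "?C > 0" by simp
  then have m: "0 < ?m" using M by linarith
  have "(\<Sum>w\<in>?W. card (?conf w)) =
      (\<Sum>p\<in>conflicts n. card {w \<in> ?W. fst p \<in> hashed_words n M B w \<and> snd p \<in> hashed_words n M B w})"
    using finW sum_multicount_gen[of ?W "conflicts n"
      "\<lambda>w p. fst p \<in> hashed_words n M B w \<and> snd p \<in> hashed_words n M B w"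
      "\<lambda>p. card {w \<in> ?W. fst p \<in> hashed_words n M B w \<and> snd p \<in> hashed_words n M B w}"]
    by (simp add: case_prod_unfold)
  then have "(\<Sum>w\<in>?W. card (?conf w)) * ?m ^ 3 = (\<Sum>p\<in>conflicts n.
      card {w \<in> ?W. fst p \<in> hashed_words n M B w \<and> snd p \<in> hashed_words n M B w} * ?m ^ 3)"
    by (simp only: sum_distrib_right)
  also have "\<dots> \<le> (\<Sum>p\<in>conflicts n. card B * ?N)"
    using card_hashed_conflict_le[OF assms(1) AP] by (intro sum_mono) simp
  also have "\<dots> \<le> ?T * (3 * ?C) * (card B * ?N)"
    using mult_right_mono[OF card_conflicts_le[of n], of "card B * ?N"] by simp
  finally have conf: "(\<Sum>w\<in>?W. card (?conf w)) * ?m ^ 3 \<le> ?T * (3 * ?C) * (card B * ?N)" .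
  have "(\<Sum>w\<in>?W. card (hashed_words n M B w)) \<le>
      (\<Sum>w\<in>?W. card (isolated_words n M B w)) + (\<Sum>w\<in>?W. card (?conf w))"
    unfolding sum.distrib[symmetric] by (rule sum_mono) (rule card_isolated_words_ge)
  then have "(\<Sum>w\<in>?W. card (hashed_words n M B w)) * ?m ^ 3 \<le>
      ((\<Sum>w\<in>?W. card (isolated_words n M B w)) + (\<Sum>w\<in>?W. card (?conf w))) * ?m ^ 3"
    by (rule mult_right_mono) simp
  moreover have "(\<Sum>w\<in>?W. card (hashed_words n M B w)) * ?m ^ 3 = ?T * card B * ?N * ?m"
    using sum_card_hashed_words[OF assms(1) B]
    by (simp only: power3_eq_cube power2_eq_square mult.assoc[symmetric])
  ultimately have "?T * card B * ?N * ?m \<le>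
      (\<Sum>w\<in>?W. card (isolated_words n M B w)) * ?m ^ 3 + ?T * (3 * ?C) * (card B * ?N)"
    using conf by (simp only: distrib_right)
  \<comment> \<open>The 6 in the bound on \<open>M\<close> is 2 * 3: conflicts through the three
    blocks may use up at most half of the total count of hashed words.\<close>
  moreover have "2 * (?T * (3 * ?C) * (card B * ?N)) \<le> ?T * card B * ?N * ?m"
    using mult_left_mono[OF M, of "?T * card B * ?N"] by (simp add: mult_ac)
  ultimately have "?T * card B * ?N * ?m \<le> 2 * ((\<Sum>w\<in>?W. card (isolated_words n M B w)) * ?m ^ 3)"
    by linarith
  then have "(?T * card B * ?N) * ?m \<le> (2 * ?m ^ 2 * (\<Sum>w\<in>?W. card (isolated_words n M B w))) * ?m"
    by (simp add: power3_eq_cube power2_eq_square mult_ac)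
  then have avg: "?T * card B * ?N \<le> 2 * ?m ^ 2 * (\<Sum>w\<in>?W. card (isolated_words n M B w))"
    using m by simp
  have "\<exists>w\<in>?W. ?T * card B \<le> 2 * ?m ^ 2 * card (isolated_words n M B w)"
  proof (rule ccontr)
    assume "\<not> ?thesis"
    then have less: "2 * ?m ^ 2 * card (isolated_words n M B w) < ?T * card B" if "w \<in> ?W" for w
      using that by force
    have "?W \<noteq> {}" using cardW m by (metis card.empty power_not_zero less_numeral_extra(3))
    then have "(\<Sum>w\<in>?W. 2 * ?m ^ 2 * card (isolated_words n M B w)) < (\<Sum>w\<in>?W. ?T * card B)"
      using finW less by (intro sum_strict_mono)
    then show False using avg cardW by (simp add: sum_distrib_left mult_ac)
  qed
  then obtain w where "?T * card B \<le> 2 * ?m ^ 2 * card (isolated_words n M B w)" by blast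
  moreover have "isolated_words n M B w \<subseteq> balanced_words n"
    unfolding isolated_words_def hashed_words_def by blast
  ultimately show ?thesis using isolated_words_local_USP[OF AP] by blast
qed

section \<open>Sets without arithmetic progressions and growth rates\<close>

lemma digits_unique:
  fixes f g :: "nat \<Rightarrow> int"
  assumes "\<And>i. i < m \<Longrightarrow> f i \<in> {0..<D}" "\<And>i. i < m \<Longrightarrow> g i \<in> {0..<D}"
    and "(\<Sum>i<m. f i * D ^ i) = (\<Sum>i<m. g i * D ^ i)" and "i < m"
  shows "f i = g i"
  using assms
proof (induction m arbitrary: f g i)
  case (Suc m)
  have split: "(\<Sum>i<Suc m. h i * D ^ i) = h 0 + D * (\<Sum>i<m. h (Suc i) * D ^ i)" for h :: "nat \<Rightarrow> int"
    unfolding sum.lessThan_Suc_shift by (simp add: sum_distrib_left mult_ac)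
  have "f 0 \<in> {0..<D}" "g 0 \<in> {0..<D}" using Suc.prems(1,2) by simp_all
  moreover have "(f 0 + D * (\<Sum>i<m. f (Suc i) * D ^ i)) mod D = (g 0 + D * (\<Sum>i<m. g (Suc i) * D ^ i)) mod D"
    using Suc.prems(3) unfolding split by simp
  ultimately have 0: "f 0 = g 0" by simp
  with Suc.prems(3) \<open>f 0 \<in> {0..<D}\<close> have "(\<Sum>i<m. f (Suc i) * D ^ i) = (\<Sum>i<m. g (Suc i) * D ^ i)"
    unfolding split by simp
  then have "f (Suc j) = g (Suc j)" if "j < m" for j
    using Suc.IH[of "\<lambda>i. f (Suc i)" "\<lambda>i. g (Suc i)" j] Suc.prems(1,2) that by simp
  then show ?case using 0 Suc.prems(4) by (cases i) simp_all
qed simp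

lemma digit_sum_bounds:
  fixes f :: "nat \<Rightarrow> int"
  assumes "0 < D" "\<And>i. i < m \<Longrightarrow> f i \<in> {0..<D}"
  shows "(\<Sum>i<m. f i * D ^ i) \<in> {0..<D ^ m}"
  using assms(2)
proof (induction m)
  case (Suc m)
  have "(\<Sum>i<m. f i * D ^ i) \<in> {0..<D ^ m}" using Suc by simp
  moreover have "0 \<le> f m" "f m \<le> D - 1" using Suc.prems[of m] by simp_all
  then have "0 \<le> f m * D ^ m" "f m * D ^ m \<le> (D - 1) * D ^ m"
    using assms(1) by (simp_all add: mult_right_mono)
  ultimately show ?case by (simp add: algebra_simps)
qed simp

text \<open>
  Behrend's construction: digit vectors on a sphere contain no three points in arithmetic
  progression, and digits at most \<open>e\<close> in base \<open>2e + 1\<close> are added without carries.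
\<close>

lemma exists_AP_free_mod:
  fixes e m :: nat
  shows "\<exists>B. AP_free_mod ((2 * int e + 1) ^ m) B \<and> (e + 1) ^ m \<le> card B * (m * e\<^sup>2 + 1)"
proof -
  let ?D = "2 * int e + 1" and ?S = "{..<m} \<rightarrow>\<^sub>E {0..int e}"
  define norm2 where "norm2 = (\<lambda>d :: nat \<Rightarrow> int. \<Sum>i<m. (d i)\<^sup>2)"
  define val where "val = (\<lambda>d :: nat \<Rightarrow> int. \<Sum>i<m. d i * ?D ^ i)"
  have digit: "0 \<le> d i" "d i \<le> int e" if "d \<in> ?S" "i < m" for d i
    using PiE_mem[OF that(1), of i] that(2) by simp_all
  have norm2: "norm2 d \<in> {0..int (m * e\<^sup>2)}" if "d \<in> ?S" for d
  proof -
    have "norm2 d \<le> (\<Sum>i<m. (int e)\<^sup>2)"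
      unfolding norm2_def using digit[OF that] by (intro sum_mono power_mono) simp_all
    then show ?thesis unfolding norm2_def by (simp add: sum_nonneg)
  qed
  have fin: "finite ?S" by (simp add: finite_PiE)
  have "norm2 \<in> ?S \<rightarrow> {0..int (m * e\<^sup>2)}" using norm2 by blast
  \<comment> \<open>Pigeonhole over the \<open>m * e\<^sup>2 + 1\<close> possible squared norms; the
    most popular one is the radius of the sphere.\<close>
  then have "\<exists>r\<in>{0..int (m * e\<^sup>2)}. card ?S \<le> card (norm2 -` {r} \<inter> ?S) * card {0..int (m * e\<^sup>2)}"
    by (rule pigeonhole_card) (use fin in simp_all)
  then obtain r where r: "card ?S \<le> card (norm2 -` {r} \<inter> ?S) * card {0..int (m * e\<^sup>2)}" by blast
  define A where "A = norm2 -` {r} \<inter> ?S"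
  have A: "d \<in> ?S" "norm2 d = r" if "d \<in> A" for d using that unfolding A_def by simp_all
  have sum_digits: "x i + y i \<in> {0..<?D}" if "x \<in> A" "y \<in> A" "i < m" for x y i
    using digit[OF A(1)[OF that(1)] that(3)] digit[OF A(1)[OF that(2)] that(3)] by simp
  have val_add: "val x + val y = (\<Sum>i<m. (x i + y i) * ?D ^ i)" for x y
    unfolding val_def by (simp add: sum.distrib distrib_right)
  have no_carry: "x = z \<and> y = z" if "x \<in> A" "y \<in> A" "z \<in> A" "val x + val y = val z + val z" for x y z
  proof -
    have eq: "x i + y i = z i + z i" if "i < m" for i
      using digits_unique[of m "\<lambda>i. x i + y i" ?D "\<lambda>i. z i + z i" i]
        sum_digits[OF \<open>x \<in> A\<close> \<open>y \<in> A\<close>] sum_digits[OF \<open>z \<in> A\<close> \<open>z \<in> A\<close>]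
        \<open>val x + val y = val z + val z\<close> that unfolding val_add by simp
    \<comment> \<open>The parallelogram law with x + y = 2z. Summed over the coordinates, with all
      three norms equal to \<open>r\<close>, it gives 2r + 2r - 4r = 0 for the squared distance of x
      and y.\<close>
    have "(x i - y i)\<^sup>2 = 2 * (x i)\<^sup>2 + 2 * (y i)\<^sup>2 - 4 * (z i)\<^sup>2" if "i < m" for i
    proof -
      have "(x i - y i)\<^sup>2 = 2 * (x i)\<^sup>2 + 2 * (y i)\<^sup>2 - (x i + y i)\<^sup>2"
        by (simp add: power2_eq_square algebra_simps)
      also have "\<dots> = 2 * (x i)\<^sup>2 + 2 * (y i)\<^sup>2 - (z i + z i)\<^sup>2" by (simp only: eq[OF that])
      finally show ?thesis by (simp add: power2_eq_square algebra_simps)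
    qed
    then have "(\<Sum>i<m. (x i - y i)\<^sup>2) = (\<Sum>i<m. 2 * (x i)\<^sup>2 + 2 * (y i)\<^sup>2 - 4 * (z i)\<^sup>2)"
      by (intro sum.cong refl) simp
    also have "\<dots> = 2 * norm2 x + 2 * norm2 y - 4 * norm2 z"
      unfolding norm2_def by (simp add: sum.distrib sum_subtractf sum_distrib_left)
    also have "\<dots> = 0" using A(2) that(1-3) by simp
    finally have zero: "(x i - y i)\<^sup>2 = 0" if "i < m" for i
      using that by (subst (asm) sum_nonneg_eq_0_iff) simp_all
    have "x i = z i \<and> y i = z i" if "i < m" for i
      using zero[OF that] eq[OF that] by simp
    then show ?thesis
      using A(1) that(1-3) by (intro conjI PiE_ext[of _ "{..<m}" "\<lambda>_. {0..int e}"]) simp_all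
  qed
  have inj: "inj_on val A"
    using no_carry by (intro inj_onI) (metis (no_types))
  have range: "val x + val y \<in> {0..<?D ^ m}" if "x \<in> A" "y \<in> A" for x y
    unfolding val_add by (rule digit_sum_bounds) (use sum_digits[OF that] in simp_all)
  have val: "val x \<in> {0..<?D ^ m}" if "x \<in> A" for x
  proof -
    have "0 \<le> val x" unfolding val_def using digit[OF A(1)[OF that]] by (intro sum_nonneg) simp
    then show ?thesis using range[OF that that] by simp
  qed
  have "AP_free_mod (?D ^ m) (val ` A)"
    unfolding AP_free_mod_def
  proof (intro conjI ballI impI image_subsetI val)
    fix a b c assume "a \<in> val ` A" "b \<in> val ` A" "c \<in> val ` A" and mod: "(a + b) mod ?D ^ m = (2 * c) mod ?D ^ m"
    then obtain x y z where xyz: "x \<in> A" "y \<in> A" "z \<in> A" "a = val x" "b = val y" "c = val z" by blast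
    \<comment> \<open>Sums of two values stay below the modulus, so the congruence is an equality of
      integers.\<close>
    have "val x + val y = val z + val z"
      using mod range[OF xyz(1,2)] range[OF xyz(3,3)] unfolding xyz(4-6) mult_2 by simp
    then have "x = z \<and> y = z" by (rule no_carry[OF xyz(1-3)])
    then show "a = c" "b = c" using xyz by simp_all
  qed
  moreover have "card ?S = (e + 1) ^ m" by (simp add: card_PiE nat_add_distrib)
  then have "(e + 1) ^ m \<le> card (val ` A) * (m * e\<^sup>2 + 1)"
    using r unfolding A_def[symmetric] by (simp add: card_image[OF inj] nat_add_distrib nat_mult_distrib nat_power_eq)
  ultimately show ?thesis by blast
qed

section \<open>Growth rates\<close>

text \<open>An elementary substitute for Stirling's formula. Consecutive binomials have the ratio
  3(3n + 1)(3n + 2) / (2(n + 1)(2n + 1)), which stays below its limit 27/4; the growth of the factor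
  3n + 1 makes up for the deficit.\<close>

lemma power_27_4_le_choose:
  "(27 / 4 :: real) ^ n \<le> (3 * real n + 1) * real (3 * n choose n)"
proof (induction n)
  case (Suc n)
  define c where "c = real (3 * n choose n)"
  define d where "d = real (3 * Suc n choose Suc n)"
  have fact: "real (3 * m choose m) = fact (3 * m) / (fact m * fact (2 * m))" for m
    using binomial_fact[of m "3 * m", where ?'a = real] by simp
  have "fact (3 * Suc n) = (real (3 * n) + 3) * (real (3 * n) + 2) * (real (3 * n) + 1) * fact (3 * n)"
    "fact (2 * Suc n) = (real (2 * n) + 2) * (real (2 * n) + 1) * fact (2 * n)"
    by (simp_all add: eval_nat_numeral algebra_simps)
  then have "d * ((real n + 1) * ((2 * n + 2) * (2 * n + 1))) =
      c * ((3 * n + 3) * (3 * n + 2) * (3 * n + 1))"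
    unfolding c_def d_def fact by (simp add: divide_simps) (simp add: algebra_simps)
  then have "(d * (2 * (2 * real n + 1) * (n + 1))) * (real n + 1) =
      (c * (3 * (3 * real n + 2) * (3 * real n + 1))) * (real n + 1)"
    by (simp add: algebra_simps)
  then have step: "d * (2 * (2 * real n + 1) * (n + 1)) = c * (3 * (3 * real n + 2) * (3 * real n + 1))"
    by (subst (asm) mult_right_cancel) simp_all
  have "27 / 4 * (3 * real n + 1) * (2 * (2 * real n + 1) * (n + 1)) \<le>
      (3 * (real n + 1) + 1) * (3 * (3 * real n + 2) * (3 * real n + 1))"
    by (simp add: algebra_simps)
  then have "27 / 4 * (3 * real n + 1) * (2 * (2 * real n + 1) * (n + 1)) * c \<le>
      (3 * (real n + 1) + 1) * (3 * (3 * real n + 2) * (3 * real n + 1)) * c"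
    by (rule mult_right_mono) (simp add: c_def)
  also have "\<dots> = (3 * (real n + 1) + 1) * (c * (3 * (3 * real n + 2) * (3 * real n + 1)))"
    by (simp only: mult_ac)
  also have "\<dots> = (3 * (real n + 1) + 1) * (d * (2 * (2 * real n + 1) * (n + 1)))"
    by (simp only: step)
  finally have "(27 / 4 * ((3 * real n + 1) * c)) * (2 * (2 * real n + 1) * (n + 1)) \<le>
      ((3 * (real n + 1) + 1) * d) * (2 * (2 * real n + 1) * (n + 1))"
    by (simp only: mult_ac)
  then have "27 / 4 * ((3 * real n + 1) * c) \<le> (3 * (real n + 1) + 1) * d"
    by (rule mult_right_le_imp_le) simp
  moreover have "(27 / 4) ^ Suc n \<le> 27 / 4 * ((3 * real n + 1) * c)"
    using Suc.IH unfolding c_def by simp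
  ultimately have "(27 / 4) ^ Suc n \<le> (3 * (real n + 1) + 1) * d" by linarith
  then show ?case by (simp only: d_def of_nat_Suc add.commute)
qed simp

text \<open>Since 8^2.41 = 2^7.23, about 150.1, the claim for n = 1 becomes an inequality between
  integers after taking hundredth powers.\<close>

lemma power_150_le: "(150 :: real) ^ n \<le> (8 ^ n) powr 2.41"
proof -
  have "(150 :: real) ^ 100 \<le> 2 ^ 723" by simp
  also have "(2 :: real) ^ 723 = 2 powr (real 723)"
    by (rule powr_realpow[symmetric]) simp
  also have "real 723 = 7.23 * real 100" by simp
  also have "(2 :: real) powr (7.23 * real 100) = (2 powr 7.23) ^ 100"
    by (simp only: powr_powr[symmetric]) (rule powr_realpow, simp)
  finally have "(150 :: real) \<le> 2 powr 7.23"
    by (rule power_mono_iff[THEN iffD1, rotated 3]) simp_all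
  also have "(2 :: real) powr 7.23 = (2 powr 3) powr 2.41"
    unfolding powr_powr by simp
  also have "(2 :: real) powr 3 = 8" by simp
  finally have "(150 :: real) ^ n \<le> (8 powr 2.41) ^ n"
    by (rule power_mono) simp
  then show ?thesis by (simp add: powr_power powr_powr mult.commute flip: powr_realpow)
qed

lemma exists_hashing_modulus:
  fixes D c :: nat
  assumes "2 \<le> D" "1 < c"
  obtains m where "0 < m" "c \<le> D ^ m" "D ^ (m - 1) < c"
proof -
  have "c \<le> D ^ c"
    using assms(1) less_exp[of c] power_mono[of 2 D c] by simp
  define m where "m = (LEAST m. c \<le> D ^ m)"
  have "c \<le> D ^ m" unfolding m_def by (rule LeastI) fact
  moreover have "m \<noteq> 0" using calculation assms(2) by (cases "m = 0") simp_all
  then have "\<not> c \<le> D ^ (m - 1)"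
    unfolding m_def by (intro not_less_Least) simp
  ultimately show ?thesis using \<open>m \<noteq> 0\<close> that by simp
qed

text \<open>
  The constant \<open>2 ^ 200\<close> makes the loss \<open>2 ^ m\<close> of Behrend's construction smaller than the
  gap between \<open>27 / 4\<close> and \<open>1000 / 150\<close>.
\<close>

lemma local_USP_card_ge:
  fixes n :: nat
  assumes n: "0 < n"
  defines "e \<equiv> (2 :: nat) ^ 200"
  shows "\<exists>U. local_USP (3 * n) U \<and> U \<subseteq> balanced_words n \<and>
    (27 / 4) ^ n \<le> 768 * (2 * e + 1) * e\<^sup>2 * real n ^ 2 * 1.007 ^ n * real (card U)"
proof -
  let ?C = "2 * n choose n"
  define D where "D = 2 * e + 1"
  have e: "0 < e" unfolding e_def by simp
  have C: "0 < ?C" by simp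
  have "2 \<le> D" "1 < 6 * ?C" using e C unfolding D_def by linarith+
  then obtain m where m: "0 < m" "6 * ?C \<le> D ^ m" "D ^ (m - 1) < 6 * ?C"
    by (rule exists_hashing_modulus)
  \<comment> \<open>\<open>6 * ?C\<close> is at most 2 ^ (3 + 2n), while \<open>D ^ (m - 1)\<close>
    is at least 2 ^ (200(m - 1)). The large base thus keeps the number \<open>m\<close> of digits
    near n / 100.\<close>
  have m_small: "100 * m \<le> n + 200"
  proof -
    have "(2 :: nat) ^ (200 * (m - 1)) = e ^ (m - 1)" unfolding e_def by (rule power_mult)
    also have "\<dots> \<le> D ^ (m - 1)" by (rule power_mono) (simp_all add: D_def)
    also have "\<dots> < 6 * ?C" by (rule m(3))
    also have "\<dots> \<le> 2 ^ 3 * 2 ^ (2 * n)" using binomial_le_pow2[of "2 * n" n] by simp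
    also have "\<dots> = 2 ^ (3 + 2 * n)" by (simp only: power_add)
    finally have "200 * (m - 1) < 3 + 2 * n" by (simp only: power_strict_increasing_iff one_less_numeral_iff semiring_norm)
    then show ?thesis using m(1) by linarith
  qed
  obtain B where B: "AP_free_mod ((2 * int e + 1) ^ m) B" "(e + 1) ^ m \<le> card B * (m * e\<^sup>2 + 1)"
    using exists_AP_free_mod by blast
  have M: "nat ((2 * int e + 1) ^ m) = D ^ m"
    by (simp add: D_def nat_power_eq nat_add_distrib nat_mult_distrib)
  from exists_large_local_USP[OF n B(1), unfolded M, OF m(2)]
  obtain U where U: "local_USP (3 * n) U" "U \<subseteq> balanced_words n"
    "card (balanced_words n) * card B \<le> 2 * (D ^ m)\<^sup>2 * card U" by blast
  have Dm: "D ^ m \<le> D * (6 * ?C)"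
  proof -
    have "D ^ m = D * D ^ (m - 1)" using m(1) by (cases m) simp_all
    also have "\<dots> \<le> D * (6 * ?C)" using m(3) by (intro mult_left_mono) simp_all
    finally show ?thesis .
  qed
  \<comment> \<open>As \<open>D \<le> 2 * (e + 1)\<close>, Behrend's set is smaller than the modulus
    by at most the factor 2 ^ m (m e^2 + 1). In the chain that follows, one factor
    \<open>D ^ m\<close> cancels; the other exceeds \<open>?C\<close> by at most a constant factor,
    so \<open>?C\<close> cancels too and \<open>3 * n choose n\<close> remains.\<close>
  have "D ^ m \<le> (2 * (e + 1)) ^ m" by (rule power_mono) (simp_all add: D_def)
  also have "\<dots> = 2 ^ m * (e + 1) ^ m" by (rule power_mult_distrib)
  also have "\<dots> \<le> 2 ^ m * (card B * (m * e\<^sup>2 + 1))" using B(2) by (rule mult_left_mono) simp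
  finally have "((3 * n choose n) * ?C) * D ^ m \<le> card (balanced_words n) * (2 ^ m * (card B * (m * e\<^sup>2 + 1)))"
    using card_balanced_words_ge by (intro mult_mono) simp_all
  also have "\<dots> = 2 ^ m * (m * e\<^sup>2 + 1) * (card (balanced_words n) * card B)"
    by (simp only: mult_ac)
  also have "\<dots> \<le> 2 ^ m * (m * e\<^sup>2 + 1) * (2 * (D ^ m)\<^sup>2 * card U)"
    using U(3) by (rule mult_left_mono) simp
  also have "\<dots> = (2 ^ m * (m * e\<^sup>2 + 1) * 2 * D ^ m * card U) * D ^ m"
    by (simp only: power2_eq_square mult_ac)
  finally have "(3 * n choose n) * ?C \<le> 2 ^ m * (m * e\<^sup>2 + 1) * 2 * D ^ m * card U"
    by (rule mult_right_le_imp_le) (simp add: D_def)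
  also have "\<dots> \<le> 2 ^ m * (m * e\<^sup>2 + 1) * 2 * (D * (6 * ?C)) * card U"
    using Dm by (intro mult_right_mono mult_left_mono) simp_all
  also have "\<dots> = (2 ^ m * (m * e\<^sup>2 + 1) * 12 * D * card U) * ?C"
    by (simp add: mult_ac)
  finally have "3 * n choose n \<le> 2 ^ m * (m * e\<^sup>2 + 1) * 12 * D * card U"
    using C by (rule mult_right_le_imp_le)
  moreover have "m * e\<^sup>2 + 1 \<le> 4 * n * e\<^sup>2"
  proof -
    have "m \<le> n + 2" using m_small by linarith
    then have "m * e\<^sup>2 \<le> (n + 2) * e\<^sup>2" by (rule mult_right_mono) simp
    moreover have "(n + 2) * e\<^sup>2 + e\<^sup>2 \<le> 4 * n * e\<^sup>2"
    proof -
      have "(n + 3) * e\<^sup>2 \<le> 4 * n * e\<^sup>2" using n by (intro mult_right_mono) simp_all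
      then show ?thesis by (simp only: distrib_right)
    qed
    moreover have "1 \<le> e\<^sup>2" using e by simp
    ultimately show ?thesis by linarith
  qed
  then have "2 ^ m * (m * e\<^sup>2 + 1) * 12 * D * card U \<le> 2 ^ m * (4 * n * e\<^sup>2) * 12 * D * card U"
    by (intro mult_right_mono mult_left_mono) simp_all
  ultimately have "3 * n choose n \<le> 2 ^ m * (4 * n * e\<^sup>2) * 12 * D * card U" by linarith
  then have choose: "real (3 * n choose n) \<le> 2 ^ m * (4 * n * real e ^ 2) * 12 * real D * card U"
    by (metis (mono_tags, opaque_lifting) of_nat_le_iff of_nat_mult of_nat_numeral of_nat_power)
  \<comment> \<open>The hundredth root of 2 is slightly below 1.007, and the 200 in
    \<open>m_small\<close> becomes the factor 4 = 2 ^ (200 / 100).\<close>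
  have "(2 :: real) ^ m \<le> 4 * 1.007 ^ n"
  proof -
    have base: "(2 :: real) \<le> 1.007 ^ 100"
    proof -
      \<comment> \<open>Two tenth powers with a rounded intermediate value keep the evaluated
        numbers small.\<close>
      have "(2 :: real) \<le> 1.072 ^ 10" by (simp add: power_divide)
      also have "\<dots> \<le> (1.007 ^ 10) ^ 10" by (intro power_mono) (simp_all add: power_divide)
      also have "\<dots> = (1.007 :: real) ^ 100" by (simp only: power_mult[symmetric]) simp
      finally show ?thesis .
    qed
    have "((2 :: real) ^ m) ^ 100 = 2 ^ (100 * m)" by (simp only: power_mult[symmetric] mult.commute)
    also have "\<dots> \<le> 2 ^ (n + 200)" using m_small by (intro power_increasing) simp_all
    also have "\<dots> = 4 ^ 100 * 2 ^ n" by (simp add: power_add)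
    also have "\<dots> \<le> 4 ^ 100 * ((1.007 :: real) ^ 100) ^ n"
      by (intro mult_left_mono power_mono base) simp_all
    also have "\<dots> = (4 * 1.007 ^ n) ^ 100"
      by (simp only: power_mult_distrib power_mult[symmetric] mult.commute)
    finally show ?thesis by (rule power_mono_iff[THEN iffD1, rotated 3]) simp_all
  qed
  then have "2 ^ m * (4 * n * real e ^ 2) * 12 * real D * card U \<le>
      (4 * 1.007 ^ n) * (4 * n * real e ^ 2) * 12 * real D * card U"
    by (intro mult_right_mono) simp_all
  with choose have "real (3 * n choose n) \<le> (4 * 1.007 ^ n) * (4 * n * real e ^ 2) * 12 * real D * card U"
    by linarith
  moreover have "3 * real n + 1 \<le> 4 * real n" using n by simp
  ultimately have "(3 * real n + 1) * real (3 * n choose n) \<le>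
      4 * real n * ((4 * 1.007 ^ n) * (4 * n * real e ^ 2) * 12 * real D * card U)"
    by (intro mult_mono) simp_all
  with power_27_4_le_choose[of n]
  have "(27 / 4) ^ n \<le> 4 * real n * ((4 * 1.007 ^ n) * (4 * n * real e ^ 2) * 12 * real D * card U)"
    by linarith
  then have "(27 / 4) ^ n \<le> 768 * real D * real e ^ 2 * real n ^ 2 * 1.007 ^ n * real (card U)"
    by (simp add: power2_eq_square mult_ac)
  moreover have "real D = 2 * real e + 1" unfolding D_def by simp
  ultimately show ?thesis using U(1,2) by (intro exI[of _ U]) (simp only:)
qed

text \<open>The factor 2 is spent in the main theorem: on the strictness of the bound for \<tau>,
  and on replacing 150^n by 150^n - 1.\<close>

lemma exists_local_USP_of_capacity:
  "\<exists>n U. 0 < n \<and> local_USP (3 * n) U \<and> U \<subseteq> balanced_words n \<and>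
     2 * 1000 ^ n \<le> real (card U) * 150 ^ n"
proof -
  define K :: real where "K = 768 * real (2 * 2 ^ 200 + 1) * real ((2 ^ 200)\<^sup>2)"
  have "(\<lambda>n. real n ^ 2 * (1 / 1.005) ^ n) \<longlonglongrightarrow> 0" by real_asymp
  then have "(\<lambda>n. 2 * K * (real n ^ 2 * (1 / 1.005) ^ n)) \<longlonglongrightarrow> 0"
    by (rule tendsto_mult_right_zero)
  then have "\<forall>\<^sub>F n in sequentially. 2 * K * (real n ^ 2 * (1 / 1.005) ^ n) < 1"
    by (rule order_tendstoD) simp
  then obtain m where m: "\<And>n. m \<le> n \<Longrightarrow> 2 * K * (real n ^ 2 * (1 / 1.005) ^ n) < 1"
    unfolding eventually_sequentially by blast
  define n where "n = Suc m"
  have "2 * K * (real n ^ 2 * (1 / 1.005) ^ n) < 1" unfolding n_def by (rule m) simp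
  then have large: "2 * K * real n ^ 2 \<le> 1.005 ^ n"
    by (simp add: power_divide divide_simps)
  obtain U where U: "local_USP (3 * n) U" "U \<subseteq> balanced_words n"
    "(27 / 4) ^ n \<le> K * real n ^ 2 * 1.007 ^ n * real (card U)"
    using local_USP_card_ge[of n] unfolding K_def n_def by auto
  \<comment> \<open>1000 * 1.005 * 1.007 = 1012.035 is at most 150 * 27/4 = 1012.5. The factor 1.007
    pays for the density of the progression-free set, and 1.005 for \<open>K\<close>, the polynomial
    and the 2.\<close>
  have "2 * 1000 ^ n * ((1.005 :: real) ^ n * 1.007 ^ n) \<le> 2 * (150 ^ n * (27 / 4) ^ n)"
    unfolding power_mult_distrib[symmetric] mult.assoc by (intro mult_left_mono power_mono) simp_all
  also have "\<dots> \<le> 2 * (150 ^ n * (K * real n ^ 2 * 1.007 ^ n * real (card U)))"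
    using U(3) by (intro mult_left_mono) simp_all
  also have "\<dots> = (2 * K * real n ^ 2) * (150 ^ n * 1.007 ^ n * real (card U))"
    by (simp only: mult_ac)
  also have "\<dots> \<le> 1.005 ^ n * (150 ^ n * 1.007 ^ n * real (card U))"
    using large by (rule mult_right_mono) simp
  also have "\<dots> = (real (card U) * 150 ^ n) * (1.005 ^ n * 1.007 ^ n)"
    by (simp only: mult_ac)
  finally have "2 * 1000 ^ n \<le> real (card U) * 150 ^ n"
    by (rule mult_right_le_imp_le) simp
  then show ?thesis using U n_def by blast
qed

section \<open>The main theorem\<close>

theorem mainTheorem3:
  shows "(\<exists>(l::nat) (k::nat) (U :: (nat \<Rightarrow> nat) set).
            3 \<le> l \<and> 1 \<le> k \<and> local_USP k U \<and>
            simultaneous_triple_product_property (Cyc_power l k) U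
              (A_prod l k) (B_prod l k) (C_prod l k) \<and>
            card (carrier (Cyc_power l k)) = l ^ k \<and>
            (\<forall>\<tau>::real.
               (\<Sum>u\<in>U. real (card (A_prod l k u) * card (B_prod l k u) * card (C_prod l k u))
                         powr (\<tau> / 3))
                 \<le> real (card (carrier (Cyc_power l k)))
               \<longrightarrow> \<tau> < 2.41))
         \<and> matmul_exponent < 2.41"
proof -
  obtain n U where n: "0 < n" and usp: "local_USP (3 * n) U" and bal: "U \<subseteq> balanced_words n"
    and size: "2 * 1000 ^ n \<le> real (card U) * 150 ^ n"
    using exists_local_USP_of_capacity by blast
  let ?l = "10 :: nat" and ?k = "3 * n" and ?m = "8 ^ n :: nat"
  \<comment> \<open>Subtracting 1 makes \<open>q\<close> strictly smaller than
    \<open>?m powr 2.41\<close>, so the final inequality is strict. The factor 2 in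
    \<open>size\<close> compensates, since \<open>150 ^ n \<le> 2 * q\<close>.\<close>
  define q :: nat where "q = 150 ^ n - 1"
  have "150 \<le> (150 :: nat) ^ n" and m8: "8 \<le> ?m" using n by (simp_all add: self_le_power)
  then have q150: "150 ^ n = q + 1" and q2: "2 \<le> q" unfolding q_def by linarith+
  have stpp: "simultaneous_triple_product_property (Cyc_power ?l ?k) U
      (A_prod ?l ?k) (B_prod ?l ?k) (C_prod ?l ?k)"
    by (rule local_USP_imp_STPP[OF _ usp]) simp
  have cards: "card (A_prod ?l ?k u) = ?m" "card (B_prod ?l ?k u) = ?m" "card (C_prod ?l ?k u) = ?m"
    if "u \<in> U" for u
    using card_balanced_prods[of ?l u n] bal that by auto
  have finU: "finite U" using bal by (rule finite_subset) simp
  have "(0 :: real) < 2 * 1000 ^ n" by simp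
  with size have "card U \<noteq> 0" by (intro notI) simp
  then have posU: "0 < card U" by simp
  have carrier: "card (carrier (Cyc_power ?l ?k)) = ?l ^ ?k"
    unfolding Cyc_power_eq by (subst card_carrier_Cyc_product) simp_all
  have pow10: "(10 :: nat) ^ (3 * n) = 1000 ^ n" by (simp add: power_mult)
  have "\<tau> < 2.41"
    if \<tau>: "(\<Sum>u\<in>U. real (card (A_prod ?l ?k u) * card (B_prod ?l ?k u) * card (C_prod ?l ?k u)) powr (\<tau> / 3))
      \<le> real (card (carrier (Cyc_power ?l ?k)))" for \<tau> :: real
  proof (rule ccontr)
    assume "\<not> \<tau> < 2.41"
    have "real (?m * ?m * ?m) powr (\<tau> / 3) = (8 ^ n) powr \<tau>"
    proof -
      have "real (?m * ?m * ?m) = (8 ^ n) powr real 3"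
        by (subst powr_realpow) (simp_all add: power3_eq_cube)
      then show ?thesis by (simp only: powr_powr) simp
    qed
    then have "(\<Sum>u\<in>U. real (card (A_prod ?l ?k u) * card (B_prod ?l ?k u) * card (C_prod ?l ?k u)) powr (\<tau> / 3)) =
        real (card U) * (8 ^ n) powr \<tau>"
      using cards by simp
    with \<tau> have "real (card U) * (8 ^ n) powr \<tau> \<le> 1000 ^ n"
      unfolding carrier pow10 by simp
    moreover have "(150 :: real) ^ n \<le> (8 ^ n) powr \<tau>"
      \<comment> \<open>For \<tau> at least 2.41, each of the summands is at least 150^n, so the sum
        is at least 2 * 1000^n, twice the order of the group.\<close>
      using power_150_le[of n] \<open>\<not> \<tau> < 2.41\<close> by (intro order_trans[OF power_150_le] powr_mono) simp_all
    then have "real (card U) * 150 ^ n \<le> real (card U) * (8 ^ n) powr \<tau>"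
      by (rule mult_left_mono) simp
    ultimately have "2 * 1000 ^ n \<le> (1000 :: real) ^ n" using size by linarith
    then show False by simp
  qed
  moreover have "matmul_exponent < 2.41"
  proof -
    have "150 ^ n \<le> 2 * q" using q150 q2 by linarith
    then have "card U * 150 ^ n \<le> card U * (2 * q)" by (rule mult_left_mono) simp
    moreover have "2 * 1000 ^ n \<le> card U * 150 ^ n"
      using size by (simp only: flip: of_nat_le_iff[where ?'a = real]) simp
    moreover have "card U * (2 * q) = 2 * (q * card U)" by simp
    ultimately have "?l ^ ?k \<le> q * card U"
      unfolding pow10 by linarith
    from scheme_of_STPP[OF _ _ stpp[unfolded Cyc_power_eq] finU refl cards, of q] this
    obtain \<alpha> \<beta> \<gamma> where scheme: "disjoint_product_scheme (card U) ?m q \<alpha> \<beta> \<gamma>"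
      by auto
    have q: "?m\<^sup>2 < q"
    proof -
      have "(2 :: nat) * 64 ^ n \<le> 2 ^ n * 64 ^ n" using n by (intro mult_right_mono self_le_power) simp_all
      also have "\<dots> \<le> 150 ^ n" unfolding power_mult_distrib[symmetric] by (rule power_mono) simp_all
      finally have "2 * 64 ^ n \<le> q + 1" unfolding q150 .
      moreover have "(64 :: nat) \<le> 64 ^ n" using n by (simp add: self_le_power)
      moreover have "?m\<^sup>2 = 64 ^ n" by (simp add: power2_eq_square flip: power_mult_distrib)
      ultimately show ?thesis by linarith
    qed
    have m: "2 \<le> ?m" using m8 by linarith
    have "matmul_exponent \<le> log ?m q"
      by (rule matmul_exponent_le[OF matmul_in_time_of_scheme[OF scheme posU m q]])
    also have "log ?m q < 2.41"
    proof -
      have "real q < real (150 ^ n)" unfolding q150 by simp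
      also have "\<dots> \<le> real ?m powr 2.41" using power_150_le by simp
      finally have less: "real q < real ?m powr 2.41" .
      have "1 < real ?m" "0 < real q" using m q2 by linarith+
      then show ?thesis using less by (subst log_less_iff)
    qed
    finally show ?thesis .
  qed
  ultimately show ?thesis
    using n usp stpp carrier by (intro conjI exI[of _ ?l] exI[of _ ?k] exI[of _ U]) simp_all
qed

end
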